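(* Let $\Sigma$ be the normal fan of a convex $n$-gon in $\mathbb{R}^2$ with ray matrix $U\in\mathbb{R}^{n\times 2}$. Let $u_{ij}=|\det U_{ij}|$, where $U_{ij}$ is the $2\times 2$ submatrix of $U$ with rows $i,j$, and assume that the $n$ maximal cones of $\Sigma$ are indexed by (that is, generated by the pairs of) rows $12,23,34,\ldots,(n-1)n,1n$. If $n$ is not a multiple of $4$ or $u_{12}u_{34}\cdots u_{n-1,n}\neq u_{1n}u_{23}\cdots u_{n-2,n-1}$, then we have: 1. ${\rm Sing}(\mathcal{A}_\Sigma)$ equals the union of all solution sets in $\mathbb{P}^{n-1}$ to the equations $$x_\rho=0\quad\text{and}\quad\Big(\prod_{\rho'\notin{\rm nb}(\tau_\rho),\ \rho'\notin J}x_{\rho'}\Big)\cdot{\rm Adj}_{\Sigma_{\tau_\rho},U_{\tau_\rho}}=0\qquad\text{for all }\rho\in J,$$ where $J$ runs over all $\frac{n(n-3)}{2}$ primitive collections of $\Sigma(1)$ and, for $\rho\in J$, $\tau_\rho$ is the cone of $\Sigma$ generated by $J\setminus\{\rho\}$; 2. $\mathcal{A}_\Sigma$ is irreducible and $\dim{\rm Sing}(\mathcal{A}_\Sigma)\leq n-4$.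
   Context: For a simplicial fan $\Sigma$ in $\mathbb{R}^d$ (here $d=2$), $\Sigma(k)$ is the set of $k$-dimensional cones, $\sigma(1)$ the set of rays of $\sigma$, $n=|\Sigma(1)|$. A ray matrix $U\in\mathbb{R}^{n\times d}$ of $\Sigma$ has rows $u_\rho$, $\rho\in\Sigma(1)$, with $u_\rho$ a nonzero generator of $\rho$. For $\sigma\in\Sigma(d)$, $U_\sigma$ is the submatrix with rows indexed by $\sigma(1)$. The universal adjoint is ${\rm Adj}_{\Sigma,U}(x)=\sum_{\sigma\in\Sigma(d)}|\det U_\sigma|\prod_{\rho\notin\sigma(1)}x_\rho$, homogeneous of degree $n-d$ in the variables $x_\rho$, $\rho\in\Sigma(1)$. $\mathbb{P}^{n-1}$ is complex projective space with homogeneous coordinates $x_\rho$; $\mathcal{A}_\Sigma=\{x\in\mathbb{P}^{n-1}:{\rm Adj}_{\Sigma,U}(x)=0\}$ and ${\rm Sing}(\mathcal{A}_\Sigma)=\{x\in\mathbb{P}^{n-1}:\partial{\rm Adj}_{\Sigma,U}/\partial x_\rho(x)=0\text{ for all }\rho\in\Sigma(1)\}$. The empty set has dimension $-1$. A primitive collection is an inclusion-minimal subset $J\subseteq\Sigma(1)$ among those not contained in a cone of $\Sigma$. For $\tau\in\Sigma(k)$: ${\rm nb}(\tau)=\{\rho\in\Sigma(1):\tau(1)\cup\{\rho\}=\sigma(1)\text{ for some }\sigma\in\Sigma(k+1)\}$. The star fan $\Sigma_\tau$ consists of the images $\overline{\sigma}$ in $\mathbb{R}^d/{\rm span}_{\mathbb{R}}(\tau)$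 of all $\sigma\in\Sigma$ having $\tau$ as a face; its rays are $\overline{\rho}$, $\rho\in{\rm nb}(\tau)$, and one identifies $x_{\overline{\rho}}=x_\rho$. Choose an invertible $d\times d$ matrix $T_\tau$ such that the rows of $U\cdot T_\tau$ labeled by $\tau(1)$ are the standard basis vectors $e_1,\ldots,e_k$. Then $U_\tau$ is the submatrix of $U\cdot T_\tau$ consisting of the last $d-k$ columns and the rows indexed by ${\rm nb}(\tau)$; it is a ray matrix for $\Sigma_\tau$ in $\mathbb{R}^{d-k}$, and ${\rm Adj}_{\Sigma_\tau,U_\tau}$ is the universal adjoint formed from $\Sigma_\tau$ and $U_\tau$ by the same formula, in the variables $x_\rho$, $\rho\in{\rm nb}(\tau)$ (a determinant of an empty matrix is $1$, so ${\rm Adj}=1$ when $k=d$).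
   Formalization: The count n(n-3)/2 of primitive collections is claimed only for n ≥ 4, since for n = 3 there is exactly one primitive collection (all three rays) and the count fails; all other claims are kept for n = 3. *)

theory Defs
  imports "HOL-Analysis.Analysis"
begin

section \<open>Fans and ray matrices\<close>

text \<open>
  A fan is the set of its cones.  The rows of a ray matrix are a family \<open>u\<close> of vectors over a
  finite index set \<open>R\<close>, and the rays are identified with their indices, so that a set of rays is a
  subset of \<open>R\<close> and the variable of the ray spanned by \<open>u i\<close> is \<open>x i\<close>.
\<close>

text \<open>The normal fan, with the convention of inner normals.\<close>

definition normal_cone :: "'a::euclidean_space set \<Rightarrow> 'a set \<Rightarrow> 'a set" where
  "normal_cone P F = {w. \<forall>x\<in>F. \<forall>y\<in>P. w \<bullet> x \<le> w \<bullet> y}"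

definition normal_fan :: "'a::euclidean_space set \<Rightarrow> 'a set set" where
  "normal_fan P = {normal_cone P F |F. F face_of P \<and> F \<noteq> {}}"

definition cones_of_dim :: "'a::euclidean_space set set \<Rightarrow> nat \<Rightarrow> 'a set set" where
  "cones_of_dim \<Sigma> k = {\<sigma> \<in> \<Sigma>. dim \<sigma> = k}"

definition is_ray_matrix :: "'a::euclidean_space set set \<Rightarrow> 'i set \<Rightarrow> ('i \<Rightarrow> 'a) \<Rightarrow> bool" where
  "is_ray_matrix \<Sigma> R u \<longleftrightarrow>
     (\<forall>i\<in>R. u i \<noteq> 0) \<and> bij_betw (\<lambda>i. convex_cone hull {u i}) R (cones_of_dim \<Sigma> 1)"

text \<open>The set \<open>\<sigma>(1)\<close>.\<close>

definition rays_of :: "'i set \<Rightarrow> ('i \<Rightarrow> 'a::euclidean_space) \<Rightarrow> 'a set \<Rightarrow> 'i set" where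
  "rays_of R u \<sigma> = {i \<in> R. (convex_cone hull {u i}) face_of \<sigma>}"

definition nb :: "'a::euclidean_space set set \<Rightarrow> 'i set \<Rightarrow> ('i \<Rightarrow> 'a) \<Rightarrow> 'a set \<Rightarrow> 'i set" where
  "nb \<Sigma> R u \<tau> =
     {i \<in> R. \<exists>\<sigma> \<in> cones_of_dim \<Sigma> (Suc (dim \<tau>)). insert i (rays_of R u \<tau>) = rays_of R u \<sigma>}"

definition in_some_cone :: "'a::euclidean_space set set \<Rightarrow> 'i set \<Rightarrow> ('i \<Rightarrow> 'a) \<Rightarrow> 'i set \<Rightarrow> bool" where
  "in_some_cone \<Sigma> R u J \<longleftrightarrow> (\<exists>\<sigma>\<in>\<Sigma>. J \<subseteq> rays_of R u \<sigma>)"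

definition primitive_collections ::
    "'a::euclidean_space set set \<Rightarrow> 'i set \<Rightarrow> ('i \<Rightarrow> 'a) \<Rightarrow> 'i set set" where
  "primitive_collections \<Sigma> R u =
     {J. J \<subseteq> R \<and> \<not> in_some_cone \<Sigma> R u J \<and> (\<forall>J'. J' \<subset> J \<longrightarrow> in_some_cone \<Sigma> R u J')}"


section \<open>The universal adjoint\<close>

text \<open>
  The absolute value of the determinant of the square matrix with rows \<open>u i\<close> for \<open>i\<close> in \<open>I\<close>.
  Another ordering of the rows only changes the sign of the determinant.  This is meaningful only
  if \<open>I\<close> has as many elements as there are columns.
\<close>

definition abs_minor :: "('i \<Rightarrow> real ^ 'd) \<Rightarrow> 'i set \<Rightarrow> real" where
  "abs_minor u I = \<bar>det (\<chi> a. u ((SOME f. bij_betw f (UNIV :: 'd set) I) a))\<bar>"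

definition universal_adjoint ::
    "(real ^ 'd) set set \<Rightarrow> 'i set \<Rightarrow> ('i \<Rightarrow> real ^ 'd) \<Rightarrow> ('i \<Rightarrow> complex) \<Rightarrow> complex" where
  "universal_adjoint \<Sigma> R u x =
     (\<Sum>\<sigma> \<in> cones_of_dim \<Sigma> CARD('d).
        of_real (abs_minor u (rays_of R u \<sigma>)) * (\<Prod>i \<in> R - rays_of R u \<sigma>. x i))"


section \<open>Star fans in the plane\<close>

text \<open>
  If \<open>T\<close> is invertible and the row of \<open>U T\<close> belonging to a ray \<open>\<tau>\<close> is the first standard basis
  vector, then \<open>v \<mapsto> v T\<close> followed by the projection to the last coordinate identifies the quotient
  of the plane by the span of \<open>\<tau>\<close> with the real line.
\<close>

definition adapted_matrix ::
    "'i set \<Rightarrow> ('i \<Rightarrow> real ^ 2) \<Rightarrow> (real ^ 2) set \<Rightarrow> real ^ 2 ^ 2 \<Rightarrow> bool" where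
  "adapted_matrix R u \<tau> T \<longleftrightarrow> invertible T \<and> (\<forall>i \<in> rays_of R u \<tau>. u i v* T = axis 1 1)"

definition quotient_map :: "real ^ 2 ^ 2 \<Rightarrow> real ^ 2 \<Rightarrow> real ^ 1" where
  "quotient_map T v = (\<chi> _. (v v* T) $ 2)"

definition star_fan :: "(real ^ 2) set set \<Rightarrow> real ^ 2 ^ 2 \<Rightarrow> (real ^ 2) set \<Rightarrow> (real ^ 1) set set" where
  "star_fan \<Sigma> T \<tau> = {quotient_map T ` \<sigma> |\<sigma>. \<sigma> \<in> \<Sigma> \<and> \<tau> face_of \<sigma>}"

text \<open>
  The universal adjoint of the star fan of \<open>\<tau>\<close>, whose ray matrix consists of the images of the
  \<open>u i\<close> with \<open>i\<close> in \<open>nb(\<tau>)\<close>.  If \<open>\<tau>\<close> has dimension 2, the star fan lives in the zero space and its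
  adjoint is 1.  The definition is meant only for \<open>\<tau>\<close> of dimension 1 or 2.
\<close>

definition star_adjoint ::
    "(real ^ 2) set set \<Rightarrow> 'i set \<Rightarrow> ('i \<Rightarrow> real ^ 2) \<Rightarrow> real ^ 2 ^ 2 \<Rightarrow> (real ^ 2) set
       \<Rightarrow> ('i \<Rightarrow> complex) \<Rightarrow> complex" where
  "star_adjoint \<Sigma> R u T \<tau> x =
     (if dim \<tau> = 2 then 1
      else universal_adjoint (star_fan \<Sigma> T \<tau>) (nb \<Sigma> R u \<tau>) (\<lambda>i. quotient_map T (u i)) x)"


section \<open>Complex projective space and its Zariski topology\<close>

text \<open>
  The projective space with homogeneous coordinates indexed by \<open>R\<close>.  A point is the class of all
  nonzero multiples of a nonzero vector; vectors are extended by 0 outside \<open>R\<close>.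
\<close>

definition proj_point :: "('i \<Rightarrow> complex) \<Rightarrow> ('i \<Rightarrow> complex) set" where
  "proj_point x = {(\<lambda>i. c * x i) |c. c \<noteq> 0}"

definition proj_space :: "'i set \<Rightarrow> ('i \<Rightarrow> complex) set set" where
  "proj_space R = {proj_point x |x. (\<forall>i. i \<notin> R \<longrightarrow> x i = 0) \<and> (\<exists>i\<in>R. x i \<noteq> 0)}"

definition proj_zeros :: "'i set \<Rightarrow> (('i \<Rightarrow> complex) \<Rightarrow> complex) set \<Rightarrow> ('i \<Rightarrow> complex) set set" where
  "proj_zeros R \<F> = {p \<in> proj_space R. \<forall>f\<in>\<F>. \<forall>x\<in>p. f x = 0}"

text \<open>
  Polynomials over the complex numbers are represented by the functions they define.  The zero
  function is homogeneous of every degree.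
\<close>

definition homogeneous_poly :: "'i set \<Rightarrow> nat \<Rightarrow> (('i \<Rightarrow> complex) \<Rightarrow> complex) \<Rightarrow> bool" where
  "homogeneous_poly R k f \<longleftrightarrow>
     (\<exists>(M :: ('i \<Rightarrow> nat) set) c. finite M \<and> (\<forall>m\<in>M. (\<Sum>i\<in>R. m i) = k) \<and>
        f = (\<lambda>x. \<Sum>m\<in>M. c m * (\<Prod>i\<in>R. x i ^ m i)))"

definition zariski_closed :: "'i set \<Rightarrow> ('i \<Rightarrow> complex) set set \<Rightarrow> bool" where
  "zariski_closed R Z \<longleftrightarrow> (\<exists>\<F>. (\<forall>f\<in>\<F>. \<exists>k. homogeneous_poly R k f) \<and> Z = proj_zeros R \<F>)"

definition zariski_irreducible :: "'i set \<Rightarrow> ('i \<Rightarrow> complex) set set \<Rightarrow> bool" where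
  "zariski_irreducible R Z \<longleftrightarrow> Z \<noteq> {} \<and>
     (\<forall>X Y. zariski_closed R X \<and> zariski_closed R Y \<and> Z \<subseteq> X \<union> Y \<longrightarrow> Z \<subseteq> X \<or> Z \<subseteq> Y)"

text \<open>
  The dimension of a closed set: the supremum of the lengths of strictly ascending chains of
  irreducible closed subsets, and \<open>-1\<close> for the empty set.  The extended reals guarantee that the
  supremum exists.
\<close>

definition zariski_dim :: "'i set \<Rightarrow> ('i \<Rightarrow> complex) set set \<Rightarrow> ereal" where
  "zariski_dim R X = Sup (insert (-1) {ereal (real r) |r. \<exists>Z :: nat \<Rightarrow> ('i \<Rightarrow> complex) set set.
     (\<forall>i\<le>r. zariski_closed R (Z i) \<and> zariski_irreducible R (Z i) \<and> Z i \<subseteq> X) \<and>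
     (\<forall>i<r. Z i \<subset> Z (Suc i))})"


section \<open>The adjoint hypersurface\<close>

definition partial_deriv :: "'i \<Rightarrow> (('i \<Rightarrow> complex) \<Rightarrow> complex) \<Rightarrow> ('i \<Rightarrow> complex) \<Rightarrow> complex" where
  "partial_deriv i f x = deriv (\<lambda>t. f (x(i := t))) (x i)"

definition adjoint_hypersurface ::
    "(real ^ 'd) set set \<Rightarrow> 'i set \<Rightarrow> ('i \<Rightarrow> real ^ 'd) \<Rightarrow> ('i \<Rightarrow> complex) set set" where
  "adjoint_hypersurface \<Sigma> R u = proj_zeros R {universal_adjoint \<Sigma> R u}"

definition adjoint_sing ::
    "(real ^ 'd) set set \<Rightarrow> 'i set \<Rightarrow> ('i \<Rightarrow> real ^ 'd) \<Rightarrow> ('i \<Rightarrow> complex) set set" where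
  "adjoint_sing \<Sigma> R u = proj_zeros R ((\<lambda>i. partial_deriv i (universal_adjoint \<Sigma> R u)) ` R)"

end

theory Submission
  imports Defs "HOL-Computational_Algebra.Polynomial"
begin

text \<open>
  Let \<open>a i = u_{i,i+1}\<close>, indices mod \<open>n\<close>. The adjoint is affine in each variable:
  \<open>Adj = x i * B i + C i\<close> with \<open>C i\<close> the product of
  \<open>L i = a (i - 1) * x (i + 1) + a i * x (i - 1)\<close> and all \<open>x l\<close> with \<open>l\<close> not among
  \<open>i - 1, i, i + 1\<close> (\<open>dadj\<close>, \<open>rest\<close> and \<open>edge_form\<close> below). At a
  singular point all \<open>B i\<close> and hence, since the \<open>C i\<close> add up to
  \<open>2 * Adj\<close>, all \<open>C i\<close> vanish. If no coordinate is zero, the equations \<open>L i = 0\<close> multiply up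
  around the polygon to the relation between the \<open>a i\<close> that is excluded. If \<open>x i = 0\<close>, then
  \<open>B (i + 1)\<close> is a nonzero multiple of the product of the \<open>x l\<close> with \<open>l\<close> not among
  \<open>i - 1, i, i + 1\<close>. So a singular point has two zero coordinates \<open>i\<close> and \<open>j\<close> that are not
  adjacent, and there the only partial derivatives that may be nonzero are the \<open>i\<close>-th and the
  \<open>j\<close>-th, which are the products in the theorem because the star fan of a ray has the adjoint
  \<open>L\<close> up to a factor.

  Where \<open>B i\<close> is nonzero, the hypersurface is a graph, hence irreducible; these charts are linked
  by common points, and the singular points are limits of smooth ones. The singular locus is
  covered by linear subspaces of codimension 3, and a chain of irreducible closed subsets of a
  projective space is bounded by counting monomials.
\<close>

section \<open>Homogeneous polynomial functions\<close>

lemma homogeneous_poly_monomial: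
  assumes "(\<Sum>i\<in>R. m i) = k"
  shows "homogeneous_poly R k (\<lambda>x. c * (\<Prod>i\<in>R. x i ^ m i))"
  unfolding homogeneous_poly_def
  by (rule exI[of _ "{m}"], rule exI[of _ "\<lambda>_. c"]) (use assms in auto)

lemma homogeneous_poly_0: "homogeneous_poly R k (\<lambda>x. 0)"
  unfolding homogeneous_poly_def by (rule exI[of _ "{}"]) auto

lemma homogeneous_poly_add:
  assumes "homogeneous_poly R k f" "homogeneous_poly R k g"
  shows "homogeneous_poly R k (\<lambda>x. f x + g x)"
proof -
  obtain M c where f: "finite M" "\<forall>m\<in>M. (\<Sum>i\<in>R. m i) = k"
    "f = (\<lambda>x. \<Sum>m\<in>M. c m * (\<Prod>i\<in>R. x i ^ m i))"
    using assms(1) unfolding homogeneous_poly_def by blast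
  obtain N d where g: "finite N" "\<forall>m\<in>N. (\<Sum>i\<in>R. m i) = k"
    "g = (\<lambda>x. \<Sum>m\<in>N. d m * (\<Prod>i\<in>R. x i ^ m i))"
    using assms(2) unfolding homogeneous_poly_def by blast
  \<comment> \<open>\<open>c\<close> is unconstrained outside \<open>M\<close>, and \<open>d\<close>
    outside \<open>N\<close>, so both are cut off to 0 before being added on the union.\<close>
  define e where "e = (\<lambda>m. (if m \<in> M then c m else 0) + (if m \<in> N then d m else 0))"
  have "f x + g x = (\<Sum>m\<in>M \<union> N. e m * (\<Prod>i\<in>R. x i ^ m i))" for x
  proof -
    have "f x = (\<Sum>m\<in>M \<union> N. (if m \<in> M then c m else 0) * (\<Prod>i\<in>R. x i ^ m i))"
      unfolding f(3) by (rule sum.mono_neutral_cong_left) (use f(1) g(1) in auto)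
    moreover have "g x = (\<Sum>m\<in>M \<union> N. (if m \<in> N then d m else 0) * (\<Prod>i\<in>R. x i ^ m i))"
      unfolding g(3) by (rule sum.mono_neutral_cong_left) (use f(1) g(1) in auto)
    ultimately show ?thesis
      by (simp add: e_def distrib_right sum.distrib)
  qed
  then show ?thesis
    unfolding homogeneous_poly_def using f(1,2) g(1,2)
    by (intro exI[of _ "M \<union> N"] exI[of _ e]) auto
qed

lemma homogeneous_poly_sum:
  assumes "\<And>a. a \<in> A \<Longrightarrow> homogeneous_poly R k (f a)"
  shows "homogeneous_poly R k (\<lambda>x. \<Sum>a\<in>A. f a x)"
  using assms
  by (induction A rule: infinite_finite_induct)
     (auto intro: homogeneous_poly_0 homogeneous_poly_add)

lemma homogeneous_poly_mult:
  assumes "homogeneous_poly R k f" "homogeneous_poly R l g"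
  shows "homogeneous_poly R (k + l) (\<lambda>x. f x * g x)"
proof -
  obtain M c where f: "finite M" "\<forall>m\<in>M. (\<Sum>i\<in>R. m i) = k"
    "f = (\<lambda>x. \<Sum>m\<in>M. c m * (\<Prod>i\<in>R. x i ^ m i))"
    using assms(1) unfolding homogeneous_poly_def by blast
  obtain N d where g: "finite N" "\<forall>m\<in>N. (\<Sum>i\<in>R. m i) = l"
    "g = (\<lambda>x. \<Sum>m\<in>N. d m * (\<Prod>i\<in>R. x i ^ m i))"
    using assms(2) unfolding homogeneous_poly_def by blast
  have "(\<lambda>x. f x * g x) =
      (\<lambda>x. \<Sum>m\<in>M. \<Sum>m'\<in>N. (c m * d m') * (\<Prod>i\<in>R. x i ^ (m i + m' i)))"
    unfolding f(3) g(3)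
    by (simp add: sum_product power_add prod.distrib mult_ac)
  \<comment> \<open>Different pairs of exponents may have the same sum, so the double sum need not
    be indexed by a set of exponents; closure under sums merges equal monomials.\<close>
  moreover have "homogeneous_poly R (k + l) \<dots>"
    by (intro homogeneous_poly_sum homogeneous_poly_monomial)
       (use f(2) g(2) in \<open>auto simp: sum.distrib\<close>)
  ultimately show ?thesis by simp
qed

lemma homogeneous_poly_const: "homogeneous_poly R 0 (\<lambda>x. c)"
  using homogeneous_poly_monomial[of "\<lambda>_. 0" R 0 c] by simp

lemma homogeneous_poly_cmult:
  "homogeneous_poly R k f \<Longrightarrow> homogeneous_poly R k (\<lambda>x. c * f x)"
  using homogeneous_poly_mult[OF homogeneous_poly_const, of R k f c] by simp

lemma homogeneous_poly_power:
  "homogeneous_poly R k f \<Longrightarrow> homogeneous_poly R (e * k) (\<lambda>x. f x ^ e)"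
  by (induction e) (use homogeneous_poly_const[of R 1] homogeneous_poly_mult in \<open>auto\<close>)

lemma homogeneous_poly_var:
  assumes "finite R" "i \<in> R"
  shows "homogeneous_poly R 1 (\<lambda>x. x i)"
proof -
  have "(\<Prod>j\<in>R. x j ^ (if j = i then 1 else 0)) = x i" for x :: "_ \<Rightarrow> complex"
    using assms by (simp add: if_distrib prod.delta cong: if_cong)
  moreover have "homogeneous_poly R 1
      (\<lambda>x. 1 * (\<Prod>j\<in>R. x j ^ (if j = i then 1 else 0)))"
    by (rule homogeneous_poly_monomial) (use assms in auto)
  ultimately show ?thesis by simp
qed

lemma homogeneous_poly_prod_vars:
  assumes "finite R" "A \<subseteq> R"
  shows "homogeneous_poly R (card A) (\<lambda>x. \<Prod>i\<in>A. x i)"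
proof -
  have "finite A" using assms finite_subset by blast
  then show ?thesis using assms(2)
  proof (induction A rule: finite_induct)
    case empty
    then show ?case using homogeneous_poly_const[of R 1] by simp
  next
    case (insert i A)
    then show ?case
      using homogeneous_poly_mult[OF homogeneous_poly_var[OF assms(1), of i] insert.IH]
      by simp
  qed
qed

lemma homogeneous_poly_cong:
  assumes "homogeneous_poly R k f" "\<And>i. i \<in> R \<Longrightarrow> x i = y i"
  shows "f x = f y"
  using assms unfolding homogeneous_poly_def by (auto intro!: sum.cong prod.cong)

lemma homogeneous_poly_scale:
  assumes "homogeneous_poly R k f"
  shows "f (\<lambda>i. c * x i) = c ^ k * f x"
proof -
  obtain M d where f: "finite M" "\<forall>m\<in>M. (\<Sum>i\<in>R. m i) = k"
    "f = (\<lambda>x. \<Sum>m\<in>M. d m * (\<Prod>i\<in>R. x i ^ m i))"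
    using assms unfolding homogeneous_poly_def by blast
  have "(\<Prod>i\<in>R. (c * x i) ^ m i) = c ^ k * (\<Prod>i\<in>R. x i ^ m i)" if "m \<in> M" for m
    using f(2) that by (simp add: power_mult_distrib prod.distrib flip: power_sum)
  then show ?thesis
    unfolding f(3) by (simp add: sum_distrib_left mult_ac)
qed

section \<open>Polynomial functions of one complex variable\<close>

definition poly_fun :: "(complex \<Rightarrow> complex) \<Rightarrow> bool" where
  "poly_fun h \<longleftrightarrow> (\<exists>p. h = poly p)"

lemma poly_fun_const [intro]: "poly_fun (\<lambda>t. c)"
  unfolding poly_fun_def by (rule exI[of _ "[:c:]"]) auto

lemma poly_fun_id [intro]: "poly_fun (\<lambda>t. t)"
  unfolding poly_fun_def by (rule exI[of _ "[:0, 1:]"]) auto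

lemma poly_fun_add [intro]: "poly_fun g \<Longrightarrow> poly_fun h \<Longrightarrow> poly_fun (\<lambda>t. g t + h t)"
  unfolding poly_fun_def fun_eq_iff by (metis poly_add)

lemma poly_fun_mult [intro]: "poly_fun g \<Longrightarrow> poly_fun h \<Longrightarrow> poly_fun (\<lambda>t. g t * h t)"
  unfolding poly_fun_def fun_eq_iff by (metis poly_mult)

lemma poly_fun_uminus [intro]: "poly_fun g \<Longrightarrow> poly_fun (\<lambda>t. - g t)"
  unfolding poly_fun_def fun_eq_iff by (metis poly_minus)

lemma poly_fun_power [intro]: "poly_fun g \<Longrightarrow> poly_fun (\<lambda>t. g t ^ k)"
  unfolding poly_fun_def fun_eq_iff by (metis poly_power)

lemma poly_fun_sum [intro]:
  "(\<And>a. a \<in> A \<Longrightarrow> poly_fun (g a)) \<Longrightarrow> poly_fun (\<lambda>t. \<Sum>a\<in>A. g a t)"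
  by (induction A rule: infinite_finite_induct) auto

lemma poly_fun_prod [intro]:
  "(\<And>a. a \<in> A \<Longrightarrow> poly_fun (g a)) \<Longrightarrow> poly_fun (\<lambda>t. \<Prod>a\<in>A. g a t)"
  by (induction A rule: infinite_finite_induct) auto

text \<open>Along a polynomial curve a form becomes a polynomial in the parameter, so counting roots
  can replace arguments of density and continuity.\<close>

lemma poly_fun_homogeneous_poly:
  assumes "homogeneous_poly R k f" "\<And>i. i \<in> R \<Longrightarrow> poly_fun (\<lambda>t. \<gamma> t i)"
  shows "poly_fun (\<lambda>t. f (\<gamma> t))"
  using assms unfolding homogeneous_poly_def by (auto intro!: poly_fun_sum poly_fun_mult poly_fun_prod poly_fun_power)

lemma finite_zeros_poly_fun:
  assumes "poly_fun h" "h t0 \<noteq> 0"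
  shows "finite {t. h t = 0}"
proof -
  obtain p where "h = poly p" using assms(1) poly_fun_def by auto
  then show ?thesis using assms(2) poly_roots_finite[of p] by fastforce
qed

text \<open>Otherwise the zeros and the nonzeros would both be finite, although together they
  exhaust the complex numbers. This is the algebraic form of passing to a limit.\<close>

lemma poly_fun_eq_0:
  assumes "poly_fun h" "finite {t. h t \<noteq> 0}"
  shows "h t = 0"
proof (rule ccontr)
  assume "h t \<noteq> 0"
  then have "finite {t. h t = 0}" by (rule finite_zeros_poly_fun[OF assms(1)])
  with assms(2) have "finite ({t. h t = 0} \<union> {t. h t \<noteq> 0})" by blast
  moreover have "{t. h t = 0} \<union> {t. h t \<noteq> 0} = (UNIV :: complex set)" by auto
  ultimately show False by (simp add: infinite_UNIV_char_0)
qed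

section \<open>Dimension of subsets of a projective linear space\<close>

definition vanishes_on :: "(('i \<Rightarrow> complex) \<Rightarrow> complex) \<Rightarrow> ('i \<Rightarrow> complex) set set \<Rightarrow> bool" where
  "vanishes_on f Z \<longleftrightarrow> (\<forall>p\<in>Z. \<forall>x\<in>p. f x = 0)"

lemma proj_zerosD:
  assumes "p \<in> proj_zeros R \<F>" "f \<in> \<F>" "x \<in> p"
  shows "f x = 0"
  using assms unfolding proj_zeros_def by simp

lemma vanishes_onD: "vanishes_on f Z \<Longrightarrow> p \<in> Z \<Longrightarrow> x \<in> p \<Longrightarrow> f x = 0"
  unfolding vanishes_on_def by blast

lemma vanishes_on_subset: "vanishes_on f Z \<Longrightarrow> Y \<subseteq> Z \<Longrightarrow> vanishes_on f Y"
  unfolding vanishes_on_def by blast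

lemma zariski_closed_proj_zeros:
  "(\<And>f. f \<in> \<F> \<Longrightarrow> \<exists>k. homogeneous_poly R k f) \<Longrightarrow> zariski_closed R (proj_zeros R \<F>)"
  unfolding zariski_closed_def by auto

lemma zariski_closed_subset: "zariski_closed R Z \<Longrightarrow> Z \<subseteq> proj_space R"
  unfolding zariski_closed_def proj_zeros_def by auto

lemma scale_in_proj_space:
  assumes "p \<in> proj_space R" "x \<in> p" "y \<in> p"
  obtains c where "c \<noteq> 0" "y = (\<lambda>i. c * x i)"
proof -
  obtain z where "p = proj_point z" using assms(1) unfolding proj_space_def by auto
  then obtain c d where c: "c \<noteq> 0" "x = (\<lambda>i. c * z i)" and d: "d \<noteq> 0" "y = (\<lambda>i. d * z i)"
    using assms(2,3) unfolding proj_point_def by auto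
  then have "y = (\<lambda>i. (d / c) * x i)" by auto
  with c(1) d(1) show ?thesis using that[of "d / c"] by simp
qed

text \<open>Two representatives of a point differ by a scalar, which changes the value of a form
  only by a power of that scalar. Hence one representative decides whether the form vanishes at the
  point.\<close>

lemma homogeneous_poly_zero_cong:
  assumes "homogeneous_poly R k f" "p \<in> proj_space R" "x \<in> p" "y \<in> p" "f x = 0"
  shows "f y = 0"
proof -
  obtain c where "y = (\<lambda>i. c * x i)" using scale_in_proj_space[OF assms(2-4)] by blast
  then show ?thesis using homogeneous_poly_scale[OF assms(1), of c x] assms(5) by simp
qed

text \<open>The vanishing ideal of an irreducible set is prime: each point of \<open>Z\<close> is a
  zero of \<open>f\<close> or of \<open>g\<close>, so the two zero sets cover \<open>Z\<close> and
  one of them contains it.\<close>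

lemma irreducible_cancel:
  assumes "zariski_irreducible R Z" "Z \<subseteq> proj_space R"
    and f: "homogeneous_poly R k f" "\<not> vanishes_on f Z"
    and g: "homogeneous_poly R l g" and fg: "vanishes_on (\<lambda>x. f x * g x) Z"
  shows "vanishes_on g Z"
proof -
  have "Z \<subseteq> proj_zeros R {f} \<union> proj_zeros R {g}"
  proof
    fix p assume p: "p \<in> Z"
    then have "p \<in> proj_space R" using assms(2) by auto
    show "p \<in> proj_zeros R {f} \<union> proj_zeros R {g}"
    proof (rule ccontr)
      assume "p \<notin> proj_zeros R {f} \<union> proj_zeros R {g}"
      then obtain x y where xy: "x \<in> p" "f x \<noteq> 0" "y \<in> p" "g y \<noteq> 0"
        using \<open>p \<in> proj_space R\<close> unfolding proj_zeros_def by auto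
      then have "f x * g x = 0" using fg p unfolding vanishes_on_def by blast
      then have "g x = 0" using xy(2) by simp
      with homogeneous_poly_zero_cong[OF g \<open>p \<in> proj_space R\<close> xy(1,3)] xy(4)
      show False by simp
    qed
  qed
  moreover have "zariski_closed R (proj_zeros R {f})" "zariski_closed R (proj_zeros R {g})"
    using f(1) g by (auto intro!: zariski_closed_proj_zeros)
  ultimately have "Z \<subseteq> proj_zeros R {f} \<or> Z \<subseteq> proj_zeros R {g}"
    using assms(1) unfolding zariski_irreducible_def by blast
  then show ?thesis
    using f(2) unfolding vanishes_on_def proj_zeros_def by auto
qed

section \<open>Finite unions of closed sets\<close>

lemma zariski_closed_Un:
  assumes "zariski_closed R X" "zariski_closed R Y"
  shows "zariski_closed R (X \<union> Y)"
proof -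
  obtain \<F> where X: "\<forall>f\<in>\<F>. \<exists>k. homogeneous_poly R k f" "X = proj_zeros R \<F>"
    using assms(1) unfolding zariski_closed_def by auto
  obtain \<G> where Y: "\<forall>f\<in>\<G>. \<exists>k. homogeneous_poly R k f" "Y = proj_zeros R \<G>"
    using assms(2) unfolding zariski_closed_def by auto
  \<comment> \<open>All pairwise products: at a point outside both sets, some \<open>f\<close> and
    some \<open>g\<close> are nonzero, and so is their product.\<close>
  let ?H = "{\<lambda>x. f x * g x |f g. f \<in> \<F> \<and> g \<in> \<G>}"
  have "X \<union> Y = proj_zeros R ?H"
  proof (intro set_eqI iffI)
    fix p assume "p \<in> X \<union> Y"
    then have "p \<in> proj_space R" "(\<forall>f\<in>\<F>. \<forall>x\<in>p. f x = 0) \<or> (\<forall>g\<in>\<G>. \<forall>x\<in>p. g x = 0)"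
      by (auto simp: X(2) Y(2) proj_zeros_def)
    then show "p \<in> proj_zeros R ?H" by (auto simp: proj_zeros_def)
  next
    fix p assume p: "p \<in> proj_zeros R ?H"
    then have ps: "p \<in> proj_space R" by (simp add: proj_zeros_def)
    show "p \<in> X \<union> Y"
    proof (rule ccontr)
      assume "p \<notin> X \<union> Y"
      then obtain f g x y where fg: "f \<in> \<F>" "g \<in> \<G>" "x \<in> p" "f x \<noteq> 0" "y \<in> p" "g y \<noteq> 0"
        using ps unfolding X(2) Y(2) proj_zeros_def by auto
      have "(\<lambda>x. f x * g x) \<in> ?H" using fg(1,2) by (intro CollectI exI[of _ f] exI[of _ g]) simp
      from proj_zerosD[OF p this fg(3)] have "f x * g x = 0" .
      then have "g x = 0" using fg(4) by simp
      obtain l where "homogeneous_poly R l g" using fg(2) Y(1) by blast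
      from homogeneous_poly_zero_cong[OF this ps fg(3,5) \<open>g x = 0\<close>] fg(6) show False by simp
    qed
  qed
  moreover have "\<forall>h\<in>?H. \<exists>k. homogeneous_poly R k h"
    using X(1) Y(1) by (blast intro: homogeneous_poly_mult)
  ultimately show ?thesis unfolding zariski_closed_def by blast
qed

lemma zariski_closed_empty:
  shows "zariski_closed R {}"
proof -
  have "{} = proj_zeros R {\<lambda>x. 1}"
    by (fastforce simp: proj_zeros_def proj_space_def proj_point_def intro: exI[of _ 1])
  then show ?thesis
    using zariski_closed_proj_zeros[of "{\<lambda>x. 1}" R] homogeneous_poly_const[of R 1] by auto
qed

lemma zariski_closed_UN:
  "finite I \<Longrightarrow> (\<And>a. a \<in> I \<Longrightarrow> zariski_closed R (X a)) \<Longrightarrow> zariski_closed R (\<Union>a\<in>I. X a)"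
  by (induction I rule: finite_induct) (auto intro: zariski_closed_Un zariski_closed_empty)

lemma irreducible_subset_UN:
  assumes "zariski_irreducible R Z" "finite I" "\<And>a. a \<in> I \<Longrightarrow> zariski_closed R (X a)"
    "Z \<subseteq> (\<Union>a\<in>I. X a)"
  shows "\<exists>a\<in>I. Z \<subseteq> X a"
  using assms(2-4)
proof (induction I rule: finite_induct)
  case empty
  then show ?case using assms(1) unfolding zariski_irreducible_def by auto
next
  case (insert b I)
  have "zariski_closed R (\<Union>a\<in>I. X a)" "zariski_closed R (X b)"
    using insert by (auto intro: zariski_closed_UN)
  moreover have "Z \<subseteq> X b \<union> (\<Union>a\<in>I. X a)" using insert.prems(2) by simp
  ultimately have "Z \<subseteq> X b \<or> Z \<subseteq> (\<Union>a\<in>I. X a)"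
    using assms(1) unfolding zariski_irreducible_def by blast
  then show ?case using insert.IH insert.prems(1) by blast
qed

text \<open>Gaussian elimination: equation \<open>j\<close> removes one unknown \<open>b\<close>,
  which leaves one equation and one unknown less. It will supply a linear relation between forms
  that outnumber the monomials.\<close>

lemma underdetermined_system:
  fixes A :: "'a \<Rightarrow> 'b \<Rightarrow> 'f::field"
  assumes "finite J" "finite I" "card J < card I"
  shows "\<exists>c. (\<exists>a\<in>I. c a \<noteq> 0) \<and> (\<forall>j\<in>J. (\<Sum>a\<in>I. c a * A a j) = 0)"
  using assms
proof (induction J arbitrary: I A rule: finite_induct)
  case empty
  then have "I \<noteq> {}" by auto
  then show ?case by (intro exI[of _ "\<lambda>_. 1"]) auto
next
  case (insert j J)
  show ?case
  proof (cases "\<exists>b\<in>I. A b j \<noteq> 0")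
    case False
    have "card J < card I" using insert by simp
    then obtain c where "\<exists>a\<in>I. c a \<noteq> 0" "\<forall>j\<in>J. (\<Sum>a\<in>I. c a * A a j) = 0"
      using insert.IH[OF insert.prems(1), of A] by blast
    then show ?thesis using False by (intro exI[of _ c]) auto
  next
    case True
    then obtain b where b: "b \<in> I" "A b j \<noteq> 0" by blast
    \<comment> \<open>The coefficients after the unknown \<open>b\<close> has been eliminated by
      means of equation \<open>j\<close>.\<close>
    define A' where "A' = (\<lambda>a k. A a k - A a j / A b j * A b k)"
    have "card J < card (I - {b})" using insert b by (simp add: card_Diff_singleton)
    then obtain c where c: "\<exists>a\<in>I - {b}. c a \<noteq> 0" "\<forall>k\<in>J. (\<Sum>a\<in>I - {b}. c a * A' a k) = 0"
      using insert.IH[of "I - {b}" A'] insert.prems(1) by blast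
    \<comment> \<open>The value at \<open>b\<close> is the solution of equation \<open>j\<close> for
      that unknown.\<close>
    define d where "d = c(b := - (\<Sum>a\<in>I - {b}. c a * A a j) / A b j)"
    have sum_d: "(\<Sum>a\<in>I. d a * A a k) =
        (\<Sum>a\<in>I - {b}. c a * A a k) - (\<Sum>a\<in>I - {b}. c a * A a j) / A b j * A b k" for k
    proof -
      have "(\<Sum>a\<in>I. d a * A a k) = d b * A b k + (\<Sum>a\<in>I - {b}. d a * A a k)"
        using insert.prems(1) b(1) by (rule sum.remove)
      also have "(\<Sum>a\<in>I - {b}. d a * A a k) = (\<Sum>a\<in>I - {b}. c a * A a k)"
        by (rule sum.cong) (auto simp: d_def)
      finally show ?thesis by (simp add: d_def)
    qed
    have "(\<Sum>a\<in>I. d a * A a k) = (\<Sum>a\<in>I - {b}. c a * A' a k)" for k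
      unfolding sum_d A'_def
      by (simp add: right_diff_distrib sum_subtractf sum_distrib_right sum_distrib_left sum_divide_distrib mult_ac)
    then have "\<forall>k\<in>J. (\<Sum>a\<in>I. d a * A a k) = 0" using c(2) by simp
    moreover have "(\<Sum>a\<in>I. d a * A a j) = 0"
      unfolding sum_d using b(2) by simp
    moreover have "\<exists>a\<in>I. d a \<noteq> 0" using c(1) by (auto simp: d_def)
    ultimately show ?thesis by blast
  qed
qed

text \<open>
  If \<open>f r\<close> vanishes on \<open>Z r\<close> but not on \<open>Z (r + 1)\<close>, then the products
  \<open>(x i) ^ m0 * f 0 ^ m 0 * \<dots> * f (r - 1) ^ m (r - 1)\<close> with all \<open>m j < K\<close> and \<open>m0\<close> making up
  the degree are linearly independent on \<open>Z r\<close>.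
\<close>

lemma independent_forms_on_chain:
  assumes "finite R"
    and irr: "\<And>i. i \<le> r \<Longrightarrow> zariski_irreducible R (Z i)"
    and closed: "\<And>i. i \<le> r \<Longrightarrow> zariski_closed R (Z i)"
    and chain: "\<And>i. i < r \<Longrightarrow> Z i \<subset> Z (Suc i)"
  shows "\<exists>E. \<forall>K D. K * E \<le> D \<longrightarrow> (\<exists>(I :: nat list set) h. finite I \<and> card I = K ^ r \<and>
    (\<forall>a\<in>I. homogeneous_poly R D (h a)) \<and>
    (\<forall>c. vanishes_on (\<lambda>x. \<Sum>a\<in>I. c a * h a x) (Z r) \<longrightarrow> (\<forall>a\<in>I. c a = 0)))"
  using irr closed chain
proof (induction r)
  case 0
  have "Z 0 \<noteq> {}" using 0(1)[of 0] by (simp add: zariski_irreducible_def)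
  moreover have "Z 0 \<subseteq> proj_space R" using 0(2)[of 0] by (simp add: zariski_closed_subset)
  ultimately obtain p where p: "p \<in> Z 0" "p \<in> proj_space R" by auto
  then obtain x i where x: "p = proj_point x" "i \<in> R" "x i \<noteq> 0"
    unfolding proj_space_def by auto
  have xp: "x \<in> p" unfolding x(1) proj_point_def by (rule CollectI, rule exI[of _ 1]) simp
  \<comment> \<open>The family consists of the single form \<open>x i ^ D\<close>, where the
    \<open>i\<close>-th coordinate is nonzero at a point of \<open>Z 0\<close>; its index is the
    empty list of exponents.\<close>
  have "\<exists>(I :: nat list set) h. finite I \<and> card I = K ^ 0 \<and>
      (\<forall>a\<in>I. homogeneous_poly R D (h a)) \<and>
      (\<forall>c. vanishes_on (\<lambda>x. \<Sum>a\<in>I. c a * h a x) (Z 0) \<longrightarrow> (\<forall>a\<in>I. c a = 0))" for K D :: nat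
  proof (intro exI[of _ "{[]}"] exI[of _ "\<lambda>_ x. x i ^ D"] conjI allI impI)
    have "homogeneous_poly R (D * 1) (\<lambda>x. x i ^ D)"
      by (intro homogeneous_poly_power homogeneous_poly_var assms(1) x(2))
    then show "\<forall>a\<in>{[]}. homogeneous_poly R D (\<lambda>x. x i ^ D)" by simp
  next
    fix c :: "nat list \<Rightarrow> complex"
    assume "vanishes_on (\<lambda>x. \<Sum>a\<in>{[]}. c a * x i ^ D) (Z 0)"
    from vanishes_onD[OF this p(1) xp] have "c [] * x i ^ D = 0" by simp
    then show "\<forall>a\<in>{[]}. c a = 0" using x(3) by simp
  qed simp_all
  then show ?case by blast
next
  case (Suc r)
  have "\<exists>E. \<forall>K D. K * E \<le> D \<longrightarrow> (\<exists>(I :: nat list set) h. finite I \<and> card I = K ^ r \<and>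
      (\<forall>a\<in>I. homogeneous_poly R D (h a)) \<and>
      (\<forall>c. vanishes_on (\<lambda>x. \<Sum>a\<in>I. c a * h a x) (Z r) \<longrightarrow> (\<forall>a\<in>I. c a = 0)))"
    by (rule Suc.IH) (use Suc.prems in auto)
  then obtain E where E: "\<And>K D. K * E \<le> D \<Longrightarrow> (\<exists>(I :: nat list set) h. finite I \<and> card I = K ^ r \<and>
      (\<forall>a\<in>I. homogeneous_poly R D (h a)) \<and>
      (\<forall>c. vanishes_on (\<lambda>x. \<Sum>a\<in>I. c a * h a x) (Z r) \<longrightarrow> (\<forall>a\<in>I. c a = 0)))"
    by blast
  have sub: "Z r \<subset> Z (Suc r)" and irr': "zariski_irreducible R (Z (Suc r))"
    using Suc.prems by auto
  have ps: "Z (Suc r) \<subseteq> proj_space R"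
    using Suc.prems(2)[of "Suc r"] by (simp add: zariski_closed_subset)
  obtain \<F> where \<F>: "\<forall>f\<in>\<F>. \<exists>k. homogeneous_poly R k f" "Z r = proj_zeros R \<F>"
    using Suc.prems(2)[of r] unfolding zariski_closed_def by auto
  obtain q where q: "q \<in> Z (Suc r)" "q \<notin> Z r" using sub by blast
  \<comment> \<open>\<open>f\<close> separates the two sets: it vanishes on \<open>Z r\<close> but
    not at the point \<open>q\<close> of \<open>Z (Suc r)\<close>.\<close>
  then obtain f where f\<F>: "f \<in> \<F>" and fq: "\<exists>x\<in>q. f x \<noteq> 0"
    using ps unfolding \<F>(2) proj_zeros_def by auto
  obtain e where hf: "homogeneous_poly R e f" using \<F>(1) f\<F> by blast
  have f0: "f x = 0" if "p \<in> Z r" "x \<in> p" for p x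
    using proj_zerosD[OF _ f\<F> that(2)] that(1) \<F>(2) by blast
  have nv: "\<not> vanishes_on (\<lambda>x. f x ^ j) (Z (Suc r))" for j
    using fq q(1) unfolding vanishes_on_def by auto
  \<comment> \<open>The new bound is \<open>E + e\<close>: the powers of \<open>f\<close> with
    exponent below \<open>K\<close> use up degree at most \<open>K * e\<close>, and
    \<open>K * E\<close> still remains for the forms from the induction hypothesis.\<close>
  have "\<exists>(I :: nat list set) h. finite I \<and> card I = K ^ Suc r \<and>
      (\<forall>a\<in>I. homogeneous_poly R D (h a)) \<and>
      (\<forall>c. vanishes_on (\<lambda>x. \<Sum>a\<in>I. c a * h a x) (Z (Suc r)) \<longrightarrow> (\<forall>a\<in>I. c a = 0))"
    if KD: "K * (E + e) \<le> D" for K D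
  proof -
    have le: "j * e \<le> D" "K * E \<le> D - j * e" if "j < K" for j
    proof -
      have "j * e \<le> K * e" using that by simp
      then show "j * e \<le> D" "K * E \<le> D - j * e"
        using KD unfolding distrib_left by linarith+
    qed
    \<comment> \<open>The cofactors of \<open>f ^ j\<close> must have degree
      \<open>D - j * e\<close>, so a separate independent family is chosen for every
      \<open>j\<close>.\<close>
    define ok where "ok = (\<lambda>j (Ih :: nat list set \<times> _). finite (fst Ih) \<and> card (fst Ih) = K ^ r \<and>
        (\<forall>a\<in>fst Ih. homogeneous_poly R (D - j * e) (snd Ih a)) \<and>
        (\<forall>c. vanishes_on (\<lambda>x. \<Sum>a\<in>fst Ih. c a * snd Ih a x) (Z r) \<longrightarrow> (\<forall>a\<in>fst Ih. c a = 0)))"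
    have "\<forall>j\<in>{..<K}. \<exists>Ih. ok j Ih"
      using E[OF le(2)] unfolding ok_def by simp
    then obtain Ih where Ih: "\<forall>j\<in>{..<K}. ok j (Ih j)"
      using bchoice by metis
    define I where "I = (\<lambda>j. fst (Ih j))"
    define h where "h = (\<lambda>j. snd (Ih j))"
    have I: "finite (I j)" "card (I j) = K ^ r"
      and hh: "\<And>a. a \<in> I j \<Longrightarrow> homogeneous_poly R (D - j * e) (h j a)"
      and ind: "\<And>c. vanishes_on (\<lambda>x. \<Sum>a\<in>I j. c a * h j a x) (Z r) \<Longrightarrow> \<forall>a\<in>I j. c a = 0"
      if "j < K" for j
      using Ih that unfolding I_def h_def ok_def by auto
    define S where "S = Sigma {..<K} I"
    \<comment> \<open>An index lists the exponents, with that of the newest form \<open>f\<close> in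
      front.\<close>
    define I' where "I' = (\<lambda>(j, l). j # l) ` S"
    define h' where "h' = (\<lambda>b x. f x ^ hd b * h (hd b) (tl b) x)"
    have inj: "inj_on (\<lambda>(j, l). j # l) S" by (auto simp: inj_on_def)
    have finS: "finite S" unfolding S_def using I(1) by auto
    have "card S = (\<Sum>j<K. card (I j))" unfolding S_def using I(1) by simp
    also have "\<dots> = K ^ Suc r" using I(2) by simp
    finally have cardI': "card I' = K ^ Suc r" unfolding I'_def using card_image[OF inj] by simp
    show ?thesis
    proof (intro exI[of _ I'] exI[of _ h'] conjI allI impI)
      show "finite I'" unfolding I'_def using finS by simp
      show "card I' = K ^ Suc r" by fact
      show "\<forall>b\<in>I'. homogeneous_poly R D (h' b)"
      proof
        fix b assume "b \<in> I'"
        then obtain j l where jl: "b = j # l" "j < K" "l \<in> I j" by (auto simp: I'_def S_def)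
        have "homogeneous_poly R (j * e + (D - j * e)) (\<lambda>x. f x ^ j * h j l x)"
          by (intro homogeneous_poly_mult homogeneous_poly_power hf hh jl)
        then show "homogeneous_poly R D (h' b)" using le(1)[OF jl(2)] by (simp add: h'_def jl(1))
      qed
      fix c assume van: "vanishes_on (\<lambda>x. \<Sum>b\<in>I'. c b * h' b x) (Z (Suc r))"
      define g where "g = (\<lambda>j x. \<Sum>l\<in>I j. c (j # l) * h j l x)"
      have hg: "homogeneous_poly R (D - j * e) (g j)" if "j < K" for j
        unfolding g_def by (intro homogeneous_poly_sum homogeneous_poly_cmult hh that)
      have sum_eq: "(\<Sum>b\<in>I'. c b * h' b x) = (\<Sum>j<K. f x ^ j * g j x)" for x
      proof -
        have "(\<Sum>b\<in>I'. c b * h' b x) = (\<Sum>(j, l)\<in>S. c (j # l) * h' (j # l) x)"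
          unfolding I'_def by (subst sum.reindex[OF inj]) (auto intro!: sum.cong)
        also have "\<dots> = (\<Sum>j<K. \<Sum>l\<in>I j. c (j # l) * h' (j # l) x)"
          unfolding S_def using I(1) by (subst sum.Sigma) auto
        also have "\<dots> = (\<Sum>j<K. f x ^ j * g j x)"
          by (simp add: h'_def g_def sum_distrib_left mult_ac)
        finally show ?thesis .
      qed
      \<comment> \<open>The coefficients are killed in order of increasing power of
        \<open>f\<close>. Once the lower ones are 0, the relation is \<open>f ^ j * t\<close>; the
        factor \<open>f ^ j\<close> cancels on \<open>Z (Suc r)\<close>, and on \<open>Z r\<close>,
        where \<open>f\<close> vanishes, only the term \<open>g j\<close> of \<open>t\<close>
        survives, whose coefficients are 0 by independence on \<open>Z r\<close>.\<close>
      have "j < K \<longrightarrow> (\<forall>l\<in>I j. c (j # l) = 0)" for j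
      proof (induction j rule: less_induct)
        case (less j)
        show ?case
        proof
          assume j: "j < K"
          define t where "t = (\<lambda>x. \<Sum>i\<in>{j..<K}. f x ^ (i - j) * g i x)"
          have "homogeneous_poly R (D - j * e) (\<lambda>x. f x ^ (i - j) * g i x)" if "i \<in> {j..<K}" for i
          proof -
            have "homogeneous_poly R ((i - j) * e + (D - i * e)) (\<lambda>x. f x ^ (i - j) * g i x)"
              using that by (intro homogeneous_poly_mult homogeneous_poly_power hf hg) auto
            moreover have "(i - j) * e + (D - i * e) = D - j * e"
              using that le(1)[of i] by (auto simp: diff_mult_distrib)
            ultimately show ?thesis by simp
          qed
          then have ht: "homogeneous_poly R (D - j * e) t"
            unfolding t_def by (rule homogeneous_poly_sum)
          have "(\<Sum>i<K. f x ^ i * g i x) = f x ^ j * t x" for x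
          proof -
            have "(\<Sum>i<K. f x ^ i * g i x) = (\<Sum>i\<in>{j..<K}. f x ^ i * g i x)"
              by (rule sum.mono_neutral_right) (use less.IH in \<open>auto simp: g_def\<close>)
            also have "\<dots> = (\<Sum>i\<in>{j..<K}. f x ^ j * (f x ^ (i - j) * g i x))"
              by (rule sum.cong) (auto simp flip: power_add mult.assoc)
            finally show ?thesis by (simp add: t_def sum_distrib_left)
          qed
          then have "vanishes_on (\<lambda>x. f x ^ j * t x) (Z (Suc r))"
            using van unfolding sum_eq by simp
          then have "vanishes_on t (Z (Suc r))"
            by (rule irreducible_cancel[OF irr' ps homogeneous_poly_power[OF hf] nv ht])
          then have "vanishes_on t (Z r)" using sub by (auto intro: vanishes_on_subset)
          moreover have "t x = g j x" if "p \<in> Z r" "x \<in> p" for p x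
          proof -
            have "t x = (\<Sum>i\<in>{j..<K}. if i = j then g j x else 0)"
              unfolding t_def by (rule sum.cong) (auto simp: f0[OF that])
            then show ?thesis using j by simp
          qed
          ultimately have "vanishes_on (g j) (Z r)" unfolding vanishes_on_def by auto
          then show "\<forall>l\<in>I j. c (j # l) = 0" using ind[OF j, of "\<lambda>l. c (j # l)"] unfolding g_def by simp
        qed
      qed
      then show "\<forall>b\<in>I'. c b = 0" by (auto simp: I'_def S_def)
    qed
  qed
  then show ?case by blast
qed

text \<open>One exponent is determined by the others because the sum is \<open>D\<close>, and each
  of the remaining \<open>N\<close> lies between 0 and \<open>D\<close>.\<close>

lemma card_exponents_le:
  fixes D :: nat
  assumes "finite R" "card R = Suc N"
  defines "M \<equiv> {m :: 'i \<Rightarrow> nat. (\<forall>i. i \<notin> R \<longrightarrow> m i = 0) \<and> (\<Sum>i\<in>R. m i) = D}"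
  shows "finite M" "card M \<le> (D + 1) ^ N"
proof -
  obtain k where k: "k \<in> R" using assms(2) by fastforce
  define P where "P = PiE (R - {k}) (\<lambda>_. {..D})"
  have "inj_on (\<lambda>m. restrict m (R - {k})) M"
  proof (rule inj_onI)
    fix m m' assume m: "m \<in> M" "m' \<in> M" and eq: "restrict m (R - {k}) = restrict m' (R - {k})"
    have *: "m i = m' i" if "i \<in> R - {k}" for i using fun_cong[OF eq, of i] that by simp
    have "(\<Sum>i\<in>R. m i) = m k + (\<Sum>i\<in>R - {k}. m i)" "(\<Sum>i\<in>R. m' i) = m' k + (\<Sum>i\<in>R - {k}. m' i)"
      using assms(1) k by (auto intro: sum.remove)
    moreover have "(\<Sum>i\<in>R - {k}. m i) = (\<Sum>i\<in>R - {k}. m' i)" using * by (rule sum.cong[OF refl])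
    ultimately have "m k = m' k" using m unfolding M_def by simp
    with * m show "m = m'" unfolding M_def by (intro ext) (metis (mono_tags, lifting) Diff_iff mem_Collect_eq singletonD)
  qed
  moreover have "(\<lambda>m. restrict m (R - {k})) ` M \<subseteq> P"
  proof -
    have "m i \<le> D" if "m \<in> M" "i \<in> R" for m i
      using that member_le_sum[OF that(2), of m] assms(1) unfolding M_def by simp
    then show ?thesis unfolding P_def by (intro image_subsetI restrict_PiE_iff[THEN iffD2]) simp
  qed
  moreover have "finite P" unfolding P_def using assms(1) by (intro finite_PiE) auto
  moreover have "card P = (D + 1) ^ N"
    unfolding P_def using assms(1,2) k by (simp add: card_PiE card_Diff_singleton)
  ultimately show "finite M" "card M \<le> (D + 1) ^ N"
    using inj_on_finite card_inj_on_le by (blast, metis)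
qed

text \<open>Two counts in degree \<open>D\<close> are compared. A chain of length \<open>r\<close>
  yields \<open>K ^ r\<close> forms that are independent on \<open>Z r\<close>. On \<open>V\<close>
  every coordinate is a multiple of one of the \<open>N + 1\<close> coordinates in
  \<open>R'\<close>, so all forms are combinations of at most \<open>(D + 1) ^ N\<close> monomials.
  As \<open>D\<close> is linear in \<open>K\<close>, a large \<open>K\<close> excludes
  \<open>r > N\<close>.\<close>

lemma irreducible_chain_length_le:
  assumes "finite R" "finite R'" "card R' = Suc N"
    and s: "\<And>i. i \<in> R \<Longrightarrow> s i \<in> R'"
    and V: "\<And>p x i. p \<in> V \<Longrightarrow> x \<in> p \<Longrightarrow> i \<in> R \<Longrightarrow> x i = l i * x (s i)"
    and irr: "\<And>i. i \<le> r \<Longrightarrow> zariski_irreducible R (Z i)"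
    and closed: "\<And>i. i \<le> r \<Longrightarrow> zariski_closed R (Z i)"
    and chain: "\<And>i. i < r \<Longrightarrow> Z i \<subset> Z (Suc i)"
    and ZV: "Z r \<subseteq> V"
  shows "r \<le> N"
proof (rule ccontr)
  assume "\<not> r \<le> N"
  then have rN: "Suc N \<le> r" by simp
  obtain E where E: "\<And>K D. K * E \<le> D \<Longrightarrow> (\<exists>(I :: nat list set) h. finite I \<and> card I = K ^ r \<and>
      (\<forall>a\<in>I. homogeneous_poly R D (h a)) \<and>
      (\<forall>c. vanishes_on (\<lambda>x. \<Sum>a\<in>I. c a * h a x) (Z r) \<longrightarrow> (\<forall>a\<in>I. c a = 0)))"
    using independent_forms_on_chain[of R r Z, OF assms(1) irr closed chain] by auto
  \<comment> \<open>Chosen so that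
    \<open>(D + 1) ^ N \<le> K ^ N * (E + 1) ^ N < K ^ N * K\<close>.\<close>
  define K where "K = Suc ((E + 1) ^ N)"
  define D where "D = K * E"
  obtain I :: "nat list set" and h where I: "finite I" "card I = K ^ r"
    and hh: "\<And>a. a \<in> I \<Longrightarrow> homogeneous_poly R D (h a)"
    and ind: "\<And>c. vanishes_on (\<lambda>x. \<Sum>a\<in>I. c a * h a x) (Z r) \<Longrightarrow> \<forall>a\<in>I. c a = 0"
    using E[of K D] unfolding D_def by auto
  define M where "M = {m. (\<forall>i. i \<notin> R' \<longrightarrow> m i = 0) \<and> (\<Sum>i\<in>R'. m i) = D}"
  have M: "finite M" "card M \<le> (D + 1) ^ N"
    using card_exponents_le[OF assms(2,3), of D] unfolding M_def by auto
  have "(D + 1) ^ N \<le> (K * (E + 1)) ^ N"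
    by (rule power_mono) (auto simp: D_def K_def)
  also have "\<dots> = K ^ N * (E + 1) ^ N" by (simp only: power_mult_distrib)
  also have "\<dots> < K ^ N * K" by (simp add: K_def)
  also have "\<dots> = K ^ Suc N" by simp
  also have "\<dots> \<le> K ^ r" using rN by (intro power_increasing) (auto simp: K_def)
  finally have less: "card M < card I" using M(2) I(2) by simp
  have "\<exists>A. \<forall>p\<in>V. \<forall>x\<in>p. h a x = (\<Sum>m\<in>M. A m * (\<Prod>k\<in>R'. x k ^ m k))" if a: "a \<in> I" for a
  proof -
    obtain Q c where Q: "finite Q" "\<forall>m\<in>Q. (\<Sum>i\<in>R. m i) = D"
      "h a = (\<lambda>x. \<Sum>m\<in>Q. c m * (\<Prod>i\<in>R. x i ^ m i))"
      using hh[OF a] unfolding homogeneous_poly_def by blast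
    \<comment> \<open>The exponents that arise from \<open>m\<close> when each \<open>x i\<close> is
      replaced by \<open>l i * x (s i)\<close>: those of all \<open>i\<close> with the same target
      are added.\<close>
    define t where "t = (\<lambda>m k. \<Sum>i\<in>{i \<in> R. s i = k}. m i :: nat)"
    have tM: "t m \<in> M" if "m \<in> Q" for m
    proof -
      have "(\<Sum>k\<in>R'. t m k) = (\<Sum>i\<in>R. m i)"
        unfolding t_def by (rule sum.group) (use assms(1,2) s in auto)
      moreover have "t m k = 0" if "k \<notin> R'" for k
      proof -
        have "{i \<in> R. s i = k} = {}" using that s by auto
        then show ?thesis unfolding t_def by (simp only: sum.empty)
      qed
      ultimately show ?thesis using Q(2) that unfolding M_def by auto
    qed
    define A where "A = (\<lambda>m'. \<Sum>m\<in>{m \<in> Q. t m = m'}. c m * (\<Prod>i\<in>R. l i ^ m i))"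
    have "h a x = (\<Sum>m\<in>M. A m * (\<Prod>k\<in>R'. x k ^ m k))" if p: "p \<in> V" "x \<in> p" for p x
    proof -
      have mono: "(\<Prod>i\<in>R. x i ^ m i) = (\<Prod>i\<in>R. l i ^ m i) * (\<Prod>k\<in>R'. x k ^ t m k)" for m
      proof -
        have "(\<Prod>i\<in>R. x i ^ m i) = (\<Prod>i\<in>R. (l i * x (s i)) ^ m i)"
          by (rule prod.cong[OF refl]) (use V[OF p] in simp)
        also have "\<dots> = (\<Prod>i\<in>R. l i ^ m i) * (\<Prod>i\<in>R. x (s i) ^ m i)"
          by (simp add: power_mult_distrib prod.distrib)
        also have "(\<Prod>i\<in>R. x (s i) ^ m i) =
            (\<Prod>k\<in>R'. \<Prod>i\<in>{i \<in> R. s i = k}. x (s i) ^ m i)"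
          by (rule prod.group[symmetric]) (use assms(1,2) s in auto)
        also have "\<dots> = (\<Prod>k\<in>R'. x k ^ t m k)"
          unfolding t_def power_sum by (intro prod.cong refl) auto
        finally show ?thesis .
      qed
      have "h a x = (\<Sum>m\<in>Q. c m * (\<Prod>i\<in>R. l i ^ m i) * (\<Prod>k\<in>R'. x k ^ t m k))"
        unfolding Q(3) mono by (simp add: mult_ac)
      also have "\<dots> = (\<Sum>m'\<in>M. \<Sum>m\<in>{m \<in> Q. t m = m'}.
          c m * (\<Prod>i\<in>R. l i ^ m i) * (\<Prod>k\<in>R'. x k ^ t m k))"
        by (rule sum.group[symmetric]) (use Q(1) M(1) tM in auto)
      also have "\<dots> = (\<Sum>m\<in>M. A m * (\<Prod>k\<in>R'. x k ^ m k))"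
        unfolding A_def sum_distrib_right by (intro sum.cong refl) auto
      finally show ?thesis .
    qed
    then show ?thesis by blast
  qed
  then obtain A where A: "\<And>a p x. a \<in> I \<Longrightarrow> p \<in> V \<Longrightarrow> x \<in> p \<Longrightarrow>
      h a x = (\<Sum>m\<in>M. A a m * (\<Prod>k\<in>R'. x k ^ m k))"
    by metis
  \<comment> \<open>There are fewer monomials than forms, so some nontrivial combination of the
    forms has only zero coefficients on \<open>V\<close>, against independence on
    \<open>Z r\<close>.\<close>
  obtain c where c: "\<exists>a\<in>I. c a \<noteq> 0" "\<forall>m\<in>M. (\<Sum>a\<in>I. c a * A a m) = 0"
    using underdetermined_system[OF M(1) I(1) less, of A] by blast
  have "(\<Sum>a\<in>I. c a * h a x) = 0" if "p \<in> Z r" "x \<in> p" for p x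
  proof -
    have "(\<Sum>a\<in>I. c a * h a x) = (\<Sum>a\<in>I. \<Sum>m\<in>M. c a * A a m * (\<Prod>k\<in>R'. x k ^ m k))"
      by (rule sum.cong[OF refl]) (use A that ZV in \<open>auto simp: sum_distrib_left mult_ac\<close>)
    also have "\<dots> = (\<Sum>m\<in>M. (\<Sum>a\<in>I. c a * A a m) * (\<Prod>k\<in>R'. x k ^ m k))"
      unfolding sum_distrib_right by (rule sum.swap)
    also have "\<dots> = 0" using c(2) by simp
    finally show ?thesis .
  qed
  then have "vanishes_on (\<lambda>x. \<Sum>a\<in>I. c a * h a x) (Z r)" unfolding vanishes_on_def by blast
  then show False using ind c(1) by blast
qed

section \<open>Adjoints of cyclically ordered rays\<close>

definition cyc_succ :: "nat \<Rightarrow> nat \<Rightarrow> nat" where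
  "cyc_succ n i = (if i = n then 1 else Suc i)"

definition cyc_pred :: "nat \<Rightarrow> nat \<Rightarrow> nat" where
  "cyc_pred n i = (if i = 1 then n else i - 1)"

lemma cyc_succ_in: "i \<in> {1..n} \<Longrightarrow> cyc_succ n i \<in> {1..n}"
  by (auto simp: cyc_succ_def)

lemma cyc_pred_in: "i \<in> {1..n} \<Longrightarrow> cyc_pred n i \<in> {1..n}"
  by (auto simp: cyc_pred_def)

lemma cyc_succ_pred: "i \<in> {1..n} \<Longrightarrow> cyc_succ n (cyc_pred n i) = i"
  by (auto simp: cyc_succ_def cyc_pred_def)

lemma cyc_pred_succ: "i \<in> {1..n} \<Longrightarrow> cyc_pred n (cyc_succ n i) = i"
  by (auto simp: cyc_succ_def cyc_pred_def)

lemma bij_betw_cyc_succ: "bij_betw (cyc_succ n) {1..n} {1..n}"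
  by (rule bij_betwI[of _ _ _ "cyc_pred n"])
     (auto simp: cyc_succ_def cyc_pred_def)

lemma bij_betw_cyc_pred: "bij_betw (cyc_pred n) {1..n} {1..n}"
  by (rule bij_betwI[of _ _ _ "cyc_succ n"])
     (auto simp: cyc_succ_def cyc_pred_def)

text \<open>
  The many disequations between cyclic neighbours would make linear arithmetic split exponentially
  often.
\<close>

declare [[linarith_neq_limit = 3]]

text \<open>The algebra detached from the fan: \<open>a i\<close> plays the role of the absolute
  minor of the rays \<open>i\<close> and \<open>cyc_succ n i\<close>.\<close>

locale cyclic_adjoint =
  fixes n :: nat and a :: "nat \<Rightarrow> real"
  assumes n3: "3 \<le> n" and a_pos: "i \<in> {1..n} \<Longrightarrow> 0 < a i"
begin

abbreviation R :: "nat set" where "R \<equiv> {1..n}"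
abbreviation sc :: "nat \<Rightarrow> nat" where "sc \<equiv> cyc_succ n"
abbreviation pr :: "nat \<Rightarrow> nat" where "pr \<equiv> cyc_pred n"

lemma cyc:
  assumes "i \<in> R"
  shows "sc i \<in> R" "pr i \<in> R" "sc (pr i) = i" "pr (sc i) = i" "sc i \<noteq> i" "pr i \<noteq> i" "sc i \<noteq> pr i"
    "i \<noteq> sc i" "i \<noteq> pr i" "pr i \<noteq> sc i"
  using assms n3 cyc_succ_in cyc_pred_in cyc_succ_pred cyc_pred_succ
  by (auto simp: cyc_succ_def cyc_pred_def)

lemma sc_eq_iff: "k \<in> R \<Longrightarrow> i \<in> R \<Longrightarrow> sc k = i \<longleftrightarrow> k = pr i"
  using cyc by metis

definition summand :: "nat \<Rightarrow> (nat \<Rightarrow> complex) \<Rightarrow> complex" where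
  "summand k x = of_real (a k) * (\<Prod>l\<in>R - {k, sc k}. x l)"

definition adj :: "(nat \<Rightarrow> complex) \<Rightarrow> complex" where
  "adj x = (\<Sum>k\<in>R. summand k x)"

text \<open>The omitted indices \<open>pr i\<close> and \<open>i\<close> are the two cones that
  contain the ray \<open>i\<close>; their summands are free of \<open>x i\<close> and make up
  \<open>rest i\<close>.\<close>

definition dadj :: "nat \<Rightarrow> (nat \<Rightarrow> complex) \<Rightarrow> complex" where
  "dadj i x = (\<Sum>k\<in>R - {pr i, i}. of_real (a k) * (\<Prod>l\<in>R - {i, k, sc k}. x l))"

definition edge_form :: "nat \<Rightarrow> (nat \<Rightarrow> complex) \<Rightarrow> complex" where
  "edge_form i x = of_real (a (pr i)) * x (sc i) + of_real (a i) * x (pr i)"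

definition rest :: "nat \<Rightarrow> (nat \<Rightarrow> complex) \<Rightarrow> complex" where
  "rest i x = edge_form i x * (\<Prod>l\<in>R - {pr i, i, sc i}. x l)"

lemma rest_eq:
  assumes i: "i \<in> R"
  shows "rest i x = summand (pr i) x + summand i x"
proof -
  have "(\<Prod>l\<in>R - {pr i, i}. x l) = x (sc i) * (\<Prod>l\<in>R - {pr i, i} - {sc i}. x l)"
    by (rule prod.remove) (use cyc[OF i] in \<open>blast+\<close>)
  moreover have "(\<Prod>l\<in>R - {i, sc i}. x l) = x (pr i) * (\<Prod>l\<in>R - {i, sc i} - {pr i}. x l)"
    by (rule prod.remove) (use cyc[OF i] in \<open>blast+\<close>)
  moreover have "R - {pr i, i} - {sc i} = R - {pr i, i, sc i}" "R - {i, sc i} - {pr i} = R - {pr i, i, sc i}"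
    by auto
  ultimately show ?thesis
    by (simp add: rest_def edge_form_def summand_def cyc[OF i] algebra_simps)
qed

lemma adj_decomp:
  assumes i: "i \<in> R"
  shows "adj x = x i * dadj i x + rest i x"
proof -
  have "adj x = (\<Sum>k\<in>R - {pr i, i}. summand k x) + (\<Sum>k\<in>{pr i, i}. summand k x)"
    unfolding adj_def by (rule sum.subset_diff) (use i cyc[OF i] in auto)
  moreover have "(\<Sum>k\<in>{pr i, i}. summand k x) = rest i x"
    unfolding rest_eq[OF i] using cyc[OF i] by simp
  moreover have "(\<Sum>k\<in>R - {pr i, i}. summand k x) = x i * dadj i x"
    unfolding dadj_def sum_distrib_left
  proof (rule sum.cong[OF refl])
    fix k assume k: "k \<in> R - {pr i, i}"
    then have "sc k \<noteq> i" using sc_eq_iff[of k i] i by auto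
    then have "(\<Prod>l\<in>R - {k, sc k}. x l) = x i * (\<Prod>l\<in>R - {k, sc k} - {i}. x l)"
      by (intro prod.remove) (use k i in auto)
    moreover have "R - {k, sc k} - {i} = R - {i, k, sc k}" by auto
    ultimately show "summand k x = x i * (of_real (a k) * (\<Prod>l\<in>R - {i, k, sc k}. x l))"
      by (simp add: summand_def)
  qed
  ultimately show ?thesis by simp
qed

lemma dadj_cong: "(\<And>k. k \<in> R \<Longrightarrow> k \<noteq> i \<Longrightarrow> x k = y k) \<Longrightarrow> dadj i x = dadj i y"
  unfolding dadj_def by (auto intro!: sum.cong prod.cong)

lemma rest_cong:
  "i \<in> R \<Longrightarrow> (\<And>k. k \<in> R \<Longrightarrow> k \<noteq> i \<Longrightarrow> x k = y k) \<Longrightarrow> rest i x = rest i y"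
  unfolding rest_def edge_form_def using cyc[of i] by (auto intro!: arg_cong2[of _ _ _ _ "(*)"] prod.cong)

lemma partial_deriv_adj:
  assumes i: "i \<in> R"
  shows "partial_deriv i adj x = dadj i x"
proof -
  have "adj (x(i := t)) = t * dadj i x + rest i x" for t
    using adj_decomp[OF i, of "x(i := t)"] dadj_cong[of i "x(i := t)" x]
      rest_cong[OF i, of "x(i := t)" x] by simp
  moreover have "((\<lambda>t. t * dadj i x + rest i x) has_field_derivative dadj i x) (at (x i))"
    by (auto intro!: derivative_eq_intros)
  ultimately show ?thesis
    unfolding partial_deriv_def by (simp add: DERIV_imp_deriv)
qed

lemma card_diff3: "distinct [i, j, k] \<Longrightarrow> {i, j, k} \<subseteq> R \<Longrightarrow> card (R - {i, j, k}) = n - 3"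
  by (subst card_Diff_subset) auto

lemma homogeneous_poly_summand: "k \<in> R \<Longrightarrow> homogeneous_poly R (n - 2) (summand k)"
proof -
  assume k: "k \<in> R"
  have "card (R - {k, sc k}) = n - 2"
    using cyc(1,5)[OF k] k by (subst card_Diff_subset) (auto simp: numeral_2_eq_2)
  then show ?thesis
    using homogeneous_poly_prod_vars[of R "R - {k, sc k}"]
    unfolding summand_def by (intro homogeneous_poly_cmult) auto
qed

lemma homogeneous_poly_adj: "homogeneous_poly R (n - 2) adj"
  unfolding adj_def by (intro homogeneous_poly_sum homogeneous_poly_summand)

lemma homogeneous_poly_rest:
  assumes "i \<in> R"
  shows "homogeneous_poly R (n - 2) (rest i)"
proof -
  have "rest i = (\<lambda>x. summand (pr i) x + summand i x)"
    by (rule ext) (rule rest_eq[OF assms])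
  then show ?thesis
    using homogeneous_poly_add[OF homogeneous_poly_summand homogeneous_poly_summand] cyc(2) assms
    by simp
qed

lemma homogeneous_poly_dadj: "i \<in> R \<Longrightarrow> homogeneous_poly R (n - 3) (dadj i)"
  unfolding dadj_def
proof (intro homogeneous_poly_sum homogeneous_poly_cmult)
  fix k assume i: "i \<in> R" and k: "k \<in> R - {pr i, i}"
  then have "card (R - {i, k, sc k}) = n - 3"
    using cyc[of k] sc_eq_iff[of k i] by (intro card_diff3) auto
  then show "homogeneous_poly R (n - 3) (\<lambda>x. \<Prod>l\<in>R - {i, k, sc k}. x l)"
    using homogeneous_poly_prod_vars[of R "R - {i, k, sc k}"] by auto
qed

lemma homogeneous_poly_edge_form: "i \<in> R \<Longrightarrow> homogeneous_poly R 1 (edge_form i)"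
  unfolding edge_form_def
  by (intro homogeneous_poly_add homogeneous_poly_cmult homogeneous_poly_var) (use cyc[of i] in auto)

text \<open>Each cone has two rays, so its summand occurs in exactly two of the
  \<open>rest i\<close>.\<close>

lemma sum_rest: "(\<Sum>i\<in>R. rest i x) = 2 * adj x"
proof -
  have "(\<Sum>i\<in>R. rest i x) = (\<Sum>i\<in>R. summand (pr i) x) + (\<Sum>i\<in>R. summand i x)"
    by (simp add: rest_eq sum.distrib)
  also have "(\<Sum>i\<in>R. summand (pr i) x) = (\<Sum>i\<in>R. summand i x)"
    by (rule sum.reindex_bij_betw[OF bij_betw_cyc_pred])
  finally show ?thesis by (simp add: adj_def)
qed

text \<open>By \<open>adj_decomp\<close> every \<open>rest k x\<close> equals \<open>adj x\<close>;
  summation gives \<open>n * adj x = 2 * adj x\<close>, and \<open>n\<close> is not 2.\<close>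

lemma singular_imp_rest_eq_0:
  assumes "\<And>i. i \<in> R \<Longrightarrow> dadj i x = 0" and i: "i \<in> R"
  shows "adj x = 0" "rest i x = 0"
proof -
  have eq: "rest k x = adj x" if "k \<in> R" for k
    using adj_decomp[OF that, of x] assms(1)[OF that] by simp
  then have "of_nat n * adj x = 2 * adj x" using sum_rest[of x] by simp
  then have "(of_nat n - 2) * adj x = 0" by (simp add: algebra_simps)
  moreover have "of_nat n \<noteq> (2 :: complex)"
  proof -
    have "of_nat n \<noteq> (of_nat 2 :: complex)" using n3 by (simp only: of_nat_eq_iff)
    then show ?thesis by simp
  qed
  ultimately show "adj x = 0" by simp
  with eq[OF i] show "rest i x = 0" by simp
qed

text \<open>Only the terms of the two cones containing \<open>i\<close> lack the factor
  \<open>x i\<close>. One of them also contains \<open>sc i\<close> and is absent from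
  \<open>dadj (sc i)\<close>; the cone \<open>pr i\<close> remains.\<close>

lemma dadj_succ_eq:
  assumes i: "i \<in> R" and "x i = 0"
  shows "dadj (sc i) x = of_real (a (pr i)) * (\<Prod>l\<in>R - {pr i, i, sc i}. x l)"
proof -
  have "dadj (sc i) x = (\<Sum>k\<in>R - {i, sc i}. of_real (a k) * (\<Prod>l\<in>R - {sc i, k, sc k}. x l))"
    by (simp add: dadj_def cyc[OF i])
  also have "\<dots> = (\<Sum>k\<in>{pr i}. of_real (a k) * (\<Prod>l\<in>R - {sc i, k, sc k}. x l))"
  proof (rule sum.mono_neutral_right)
    show "\<forall>k\<in>R - {i, sc i} - {pr i}. of_real (a k) * (\<Prod>l\<in>R - {sc i, k, sc k}. x l) = 0"
    proof
      fix k assume k: "k \<in> R - {i, sc i} - {pr i}"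
      then have "i \<in> R - {sc i, k, sc k}" using i sc_eq_iff[of k i] cyc[OF i] by auto
      then have "(\<Prod>l\<in>R - {sc i, k, sc k}. x l) = 0" using assms(2) by (intro prod_zero) auto
      then show "of_real (a k) * (\<Prod>l\<in>R - {sc i, k, sc k}. x l) = 0" by simp
    qed
    show "finite (R - {i, sc i})" by simp
    show "{pr i} \<subseteq> R - {i, sc i}" using cyc(2,6,10)[OF i] by auto
  qed
  also have "\<dots> = of_real (a (pr i)) * (\<Prod>l\<in>R - {sc i, pr i, i}. x l)"
    using cyc(3)[OF i] by simp
  finally show ?thesis by (simp only: insert_commute)
qed

text \<open>These pairs turn out to be the primitive collections with two elements.\<close>

definition nonadj :: "nat \<Rightarrow> nat \<Rightarrow> bool" where
  "nonadj i j \<longleftrightarrow> i \<in> R \<and> j \<in> R \<and> i \<noteq> j \<and> j \<noteq> sc i \<and> i \<noteq> sc j"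

lemma nonadj_sym: "nonadj i j \<Longrightarrow> nonadj j i"
  by (auto simp: nonadj_def)

lemma nonadj:
  assumes "nonadj i j"
  shows "i \<in> R" "j \<in> R" "i \<noteq> j" "j \<noteq> sc i" "i \<noteq> sc j" "j \<noteq> pr i" "i \<noteq> pr j"
  using assms cyc unfolding nonadj_def by metis+

text \<open>The terms without the factor \<open>x j\<close> belong to the cones \<open>pr j\<close>
  and \<open>j\<close>; their common factor is split off and \<open>edge_form j\<close> is
  left.\<close>

lemma dadj_nonadj:
  assumes ij: "nonadj i j" and "x j = 0"
  shows "dadj i x = edge_form j x * (\<Prod>l\<in>R - {i, j, pr j, sc j}. x l)"
proof -
  note j = cyc[OF nonadj(2)[OF ij]]
  have ne: "pr j \<noteq> pr i" using cyc[of i] cyc[of j] nonadj[OF ij] by metis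
  have "dadj i x = (\<Sum>k\<in>{pr j, j}. of_real (a k) * (\<Prod>l\<in>R - {i, k, sc k}. x l))"
    unfolding dadj_def
  proof (rule sum.mono_neutral_right)
    show "\<forall>k\<in>R - {pr i, i} - {pr j, j}. of_real (a k) * (\<Prod>l\<in>R - {i, k, sc k}. x l) = 0"
    proof
      fix k assume k: "k \<in> R - {pr i, i} - {pr j, j}"
      then have "j \<in> R - {i, k, sc k}" using sc_eq_iff[of k j] nonadj[OF ij] by auto
      then have "(\<Prod>l\<in>R - {i, k, sc k}. x l) = 0" using assms(2) by (intro prod_zero) auto
      then show "of_real (a k) * (\<Prod>l\<in>R - {i, k, sc k}. x l) = 0" by simp
    qed
    show "{pr j, j} \<subseteq> R - {pr i, i}" using j(2,6) nonadj(1-3,6,7)[OF ij] ne by (simp only: insert_subset Diff_iff insert_iff empty_iff empty_subsetI) metis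
  qed auto
  also have "\<dots> = of_real (a (pr j)) * (\<Prod>l\<in>R - {i, pr j, j}. x l)
      + of_real (a j) * (\<Prod>l\<in>R - {i, j, sc j}. x l)"
    using j(3,6) by simp
  also have "(\<Prod>l\<in>R - {i, pr j, j}. x l) = x (sc j) * (\<Prod>l\<in>R - {i, pr j, j} - {sc j}. x l)"
    by (rule prod.remove) (use j(1,2,5-7,10) nonadj[OF ij] in \<open>blast+\<close>)
  also have "(\<Prod>l\<in>R - {i, j, sc j}. x l) = x (pr j) * (\<Prod>l\<in>R - {i, j, sc j} - {pr j}. x l)"
    by (rule prod.remove) (use j(1,2,5-7,10) nonadj[OF ij] in \<open>blast+\<close>)
  also have "R - {i, pr j, j} - {sc j} = R - {i, j, pr j, sc j}" by auto
  also have "R - {i, j, sc j} - {pr j} = R - {i, j, pr j, sc j}" by auto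
  finally show ?thesis by (simp add: edge_form_def algebra_simps)
qed

text \<open>No cone contains both \<open>i\<close> and \<open>j\<close>, so every term of
  \<open>dadj m\<close> keeps one of the factors \<open>x i\<close> and \<open>x j\<close>.\<close>

lemma dadj_nonadj_other:
  assumes ij: "nonadj i j" and "x i = 0" "x j = 0" and m: "m \<noteq> i" "m \<noteq> j"
  shows "dadj m x = 0"
  unfolding dadj_def
proof (rule sum.neutral, rule ballI)
  fix k assume k: "k \<in> R - {pr m, m}"
  have "i \<in> R - {m, k, sc k} \<or> j \<in> R - {m, k, sc k}"
    using nonadj[OF ij] m by auto
  then have "(\<Prod>l\<in>R - {m, k, sc k}. x l) = 0" using assms(2,3) by (intro prod_zero) auto
  then show "of_real (a k) * (\<Prod>l\<in>R - {m, k, sc k}. x l) = 0" by simp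
qed

lemma adj_nonadj:
  assumes ij: "nonadj i j" and "x i = 0" "x j = 0"
  shows "adj x = 0"
proof -
  have "j \<in> R - {pr i, i, sc i}" using nonadj[OF ij] by auto
  then have "(\<Prod>l\<in>R - {pr i, i, sc i}. x l) = 0" using assms(3) by (intro prod_zero) auto
  then show ?thesis using adj_decomp[of i x] nonadj[OF ij] assms(2) by (simp add: rest_def)
qed

text \<open>Multiplied over all \<open>i\<close>, the equations \<open>edge_form i x = 0\<close>
  leave only \<open>(- 1) ^ n = 1\<close>, since weights and coordinates cancel; thus
  \<open>n = 2 * m\<close>. Multiplied over even \<open>i\<close> only, they compare the odd weights
  with the even ones up to the sign \<open>(- 1) ^ m\<close>, and positivity of the weights forces
  \<open>m\<close> to be even.\<close>

lemma edge_form_torus_zero_imp: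
  assumes nz: "\<And>i. i \<in> R \<Longrightarrow> x i \<noteq> 0" and zero: "\<And>i. i \<in> R \<Longrightarrow> edge_form i x = 0"
  shows "4 dvd n" "(\<Prod>i = 1..n div 2. a (2 * i - 1)) = a n * (\<Prod>i = 1..n div 2 - 1. a (2 * i))"
proof -
  let ?a = "\<lambda>i. complex_of_real (a i)"
  have anz: "?a i \<noteq> 0" if "i \<in> R" for i using a_pos[OF that] by simp
  have rec: "?a (pr i) * x (sc i) = - (?a i * x (pr i))" if "i \<in> R" for i
    using zero[OF that] by (simp add: edge_form_def add_eq_0_iff2)
  have "(\<Prod>i\<in>R. ?a (pr i) * x (sc i)) = (\<Prod>i\<in>R. - (?a i * x (pr i)))"
    by (rule prod.cong[OF refl rec])
  also have "(\<Prod>i\<in>R. ?a (pr i) * x (sc i)) = (\<Prod>i\<in>R. ?a (pr i)) * (\<Prod>i\<in>R. x (sc i))"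
    by (rule prod.distrib)
  also have "(\<Prod>i\<in>R. ?a (pr i)) = (\<Prod>i\<in>R. ?a i)"
    by (rule prod.reindex_bij_betw[OF bij_betw_cyc_pred])
  also have "(\<Prod>i\<in>R. x (sc i)) = (\<Prod>i\<in>R. x i)"
    by (rule prod.reindex_bij_betw[OF bij_betw_cyc_succ])
  also have "(\<Prod>i\<in>R. - (?a i * x (pr i))) = (- 1) ^ n * ((\<Prod>i\<in>R. ?a i) * (\<Prod>i\<in>R. x (pr i)))"
    by (subst prod_uminus) (simp add: prod.distrib)
  also have "(\<Prod>i\<in>R. x (pr i)) = (\<Prod>i\<in>R. x i)"
    by (rule prod.reindex_bij_betw[OF bij_betw_cyc_pred])
  finally have "(- 1) ^ n = (1 :: complex)"
    using nz anz by (simp del: of_real_prod)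
  then have "even n" by (cases "even n") auto
  then obtain m where m: "n = 2 * m" by blast
  then have m1: "1 \<le> m" using n3 by simp
  \<comment> \<open>The edge form at an even index involves only the two neighbouring coordinates,
    whose indices are odd.\<close>
  have "(\<Prod>i\<in>{1..m}. ?a (2 * i - 1) * x (sc (2 * i))) = (\<Prod>i\<in>{1..m}. - (?a (2 * i) * x (2 * i - 1)))"
  proof (rule prod.cong[OF refl])
    fix i assume "i \<in> {1..m}"
    then have "2 * i \<in> R" "pr (2 * i) = 2 * i - 1" by (auto simp: m cyc_pred_def)
    then show "?a (2 * i - 1) * x (sc (2 * i)) = - (?a (2 * i) * x (2 * i - 1))"
      using rec[of "2 * i"] by simp
  qed
  also have "\<dots> = (- 1) ^ m * ((\<Prod>i\<in>{1..m}. ?a (2 * i)) * (\<Prod>i\<in>{1..m}. x (2 * i - 1)))"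
    by (subst prod_uminus) (simp add: prod.distrib)
  also have "(\<Prod>i\<in>{1..m}. ?a (2 * i - 1) * x (sc (2 * i))) =
      (\<Prod>i\<in>{1..m}. ?a (2 * i - 1)) * (\<Prod>i\<in>{1..m}. x (sc (2 * i)))"
    by (rule prod.distrib)
  \<comment> \<open>The odd indices form a cycle of length \<open>m\<close>, on which the shift by
    two steps is \<open>cyc_succ m\<close>; the last one returns to the index 1.\<close>
  also have "(\<Prod>i\<in>{1..m}. x (sc (2 * i))) = (\<Prod>i\<in>{1..m}. x (2 * cyc_succ m i - 1))"
    by (rule prod.cong) (auto simp: cyc_succ_def m)
  also have "\<dots> = (\<Prod>i\<in>{1..m}. x (2 * i - 1))"
    by (rule prod.reindex_bij_betw[OF bij_betw_cyc_succ])
  finally have "(\<Prod>i\<in>{1..m}. ?a (2 * i - 1)) * (\<Prod>i\<in>{1..m}. x (2 * i - 1)) =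
      ((- 1) ^ m * (\<Prod>i\<in>{1..m}. ?a (2 * i))) * (\<Prod>i\<in>{1..m}. x (2 * i - 1))"
    by (simp only: mult.assoc)
  moreover have "(\<Prod>i\<in>{1..m}. x (2 * i - 1)) \<noteq> 0"
  proof -
    have "x (2 * i - 1) \<noteq> 0" if "i \<in> {1..m}" for i
      by (rule nz) (use that in \<open>auto simp: m\<close>)
    then show ?thesis by simp
  qed
  ultimately have "(\<Prod>i\<in>{1..m}. ?a (2 * i - 1)) = (- 1) ^ m * (\<Prod>i\<in>{1..m}. ?a (2 * i))"
    by simp
  then have "of_real (\<Prod>i\<in>{1..m}. a (2 * i - 1)) = complex_of_real ((- 1) ^ m * (\<Prod>i\<in>{1..m}. a (2 * i)))"
    by simp
  then have eq: "(\<Prod>i\<in>{1..m}. a (2 * i - 1)) = (- 1) ^ m * (\<Prod>i\<in>{1..m}. a (2 * i))"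
    by (simp only: of_real_eq_iff)
  have pos: "0 < (\<Prod>i\<in>{1..m}. a (2 * i - 1))" "0 < (\<Prod>i\<in>{1..m}. a (2 * i))"
    by (auto intro!: prod_pos a_pos simp: m)
  have "even m"
  proof (rule ccontr)
    assume "odd m"
    then show False using eq pos by simp
  qed
  then show "4 dvd n" using m by auto
  \<comment> \<open>The last even weight is \<open>a n\<close>, the weight of the closing cone, and
    is split off to match the form of the genericity condition.\<close>
  have "{1..m} = insert m {1..m - 1}" using m1 by auto
  then have "(\<Prod>i\<in>{1..m}. a (2 * i)) = a n * (\<Prod>i\<in>{1..m - 1}. a (2 * i))"
    using m1 by (subst \<open>{1..m} = _\<close>, subst prod.insert) (auto simp: m)
  then show "(\<Prod>i = 1..n div 2. a (2 * i - 1)) = a n * (\<Prod>i = 1..n div 2 - 1. a (2 * i))"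
    using eq \<open>even m\<close> m by simp
qed

end

section \<open>Singular points and smooth charts of the affine cone\<close>

locale generic_cyclic_adjoint = cyclic_adjoint +
  assumes generic: "\<not> 4 dvd n \<or>
    (\<Prod>i = 1..n div 2. a (2 * i - 1)) \<noteq> a n * (\<Prod>i = 1..n div 2 - 1. a (2 * i))"
begin

lemma singular_imp_nonadj_zeros:
  assumes sing: "\<And>i. i \<in> R \<Longrightarrow> dadj i x = 0"
  shows "\<exists>i j. nonadj i j \<and> x i = 0 \<and> x j = 0"
proof (rule ccontr)
  assume none: "\<not> ?thesis"
  show False
  proof (cases "\<exists>i\<in>R. x i = 0")
    case True
    then obtain i where i: "i \<in> R" "x i = 0" by blast
    have "x l \<noteq> 0" if l: "l \<in> R - {pr i, i, sc i}" for l
    proof -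
      have "i \<noteq> sc l" using l sc_eq_iff[of l i] i(1) by blast
      then have "nonadj i l" using l i(1) unfolding nonadj_def by blast
      then show ?thesis using none i(2) by blast
    qed
    then have "(\<Prod>l\<in>R - {pr i, i, sc i}. x l) \<noteq> 0" by simp
    moreover have "a (pr i) \<noteq> 0" using a_pos[OF cyc(2)[OF i(1)]] by simp
    ultimately show False using dadj_succ_eq[of i x, OF i] sing[OF cyc(1)[OF i(1)]] by simp
  next
    case False
    then have nz: "x i \<noteq> 0" if "i \<in> R" for i using that by blast
    have "edge_form i x = 0" if i: "i \<in> R" for i
    proof -
      have "(\<Prod>l\<in>R - {pr i, i, sc i}. x l) \<noteq> 0" using nz by auto
      then show ?thesis using singular_imp_rest_eq_0(2)[OF sing i] by (simp add: rest_def)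
    qed
    then show False using edge_form_torus_zero_imp[of x, OF nz] generic by blast
  qed
qed

definition smooth_chart :: "nat \<Rightarrow> (nat \<Rightarrow> complex) set" where
  "smooth_chart i = {x. adj x = 0 \<and> dadj i x \<noteq> 0}"

text \<open>
  Where \<open>dadj i\<close> does not vanish, the hypersurface is the graph of \<open>x i = - rest i x / dadj i x\<close>
  over an affine space, so two points can be joined by the image of a line.
\<close>

lemma smooth_chart_irreducible:
  assumes i: "i \<in> R" and f: "homogeneous_poly R k f" and g: "homogeneous_poly R l g"
    and fg: "\<And>x. x \<in> smooth_chart i \<Longrightarrow> f x * g x = 0"
  shows "(\<forall>x\<in>smooth_chart i. f x = 0) \<or> (\<forall>x\<in>smooth_chart i. g x = 0)"
proof (rule ccontr)
  assume "\<not> ?thesis"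
  then obtain p q where p: "p \<in> smooth_chart i" "f p \<noteq> 0" and q: "q \<in> smooth_chart i" "g q \<noteq> 0"
    by blast
  define y where "y = (\<lambda>t k. p k + t * (q k - p k))"
  \<comment> \<open>The graph point over \<open>y t\<close> with all coordinates multiplied by
    \<open>dadj i (y t)\<close>: this clears the denominator, so the curve is polynomial in
    \<open>t\<close>.\<close>
  define \<gamma> where "\<gamma> = (\<lambda>t k. if k = i then - rest i (y t) else dadj i (y t) * y t k)"
  have polyy: "poly_fun (\<lambda>t. y t k)" for k unfolding y_def by (intro poly_fun_add poly_fun_mult poly_fun_const poly_fun_id)
  have polyd: "poly_fun (\<lambda>t. dadj i (y t))"
    by (rule poly_fun_homogeneous_poly[OF homogeneous_poly_dadj[OF i] polyy])
  have polyr: "poly_fun (\<lambda>t. rest i (y t))"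
    by (rule poly_fun_homogeneous_poly[OF homogeneous_poly_rest[OF i] polyy])
  have poly\<gamma>: "poly_fun (\<lambda>t. \<gamma> t k)" for k
    unfolding \<gamma>_def using polyy polyd polyr by (cases "k = i") auto
  have dadj_\<gamma>: "dadj i (\<gamma> t) = dadj i (y t) ^ (n - 2)" for t
  proof -
    have "dadj i (\<gamma> t) = dadj i (\<lambda>k. dadj i (y t) * y t k)"
      by (rule dadj_cong) (simp add: \<gamma>_def)
    also have "\<dots> = dadj i (y t) ^ (n - 3) * dadj i (y t)"
      by (rule homogeneous_poly_scale[OF homogeneous_poly_dadj[OF i]])
    also have "\<dots> = dadj i (y t) ^ Suc (n - 3)" by simp
    also have "Suc (n - 3) = n - 2" using n3 by simp
    finally show ?thesis .
  qed
  have adj_\<gamma>: "adj (\<gamma> t) = 0" for t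
  proof -
    have "rest i (\<gamma> t) = rest i (\<lambda>k. dadj i (y t) * y t k)"
      by (rule rest_cong[OF i]) (simp add: \<gamma>_def)
    also have "\<dots> = dadj i (y t) ^ (n - 2) * rest i (y t)"
      by (rule homogeneous_poly_scale[OF homogeneous_poly_rest[OF i]])
    finally have "rest i (\<gamma> t) = dadj i (y t) ^ (n - 2) * rest i (y t)" .
    moreover have "\<gamma> t i = - rest i (y t)" by (simp add: \<gamma>_def)
    ultimately show ?thesis
      using adj_decomp[OF i, of "\<gamma> t"] by (simp add: dadj_\<gamma>)
  qed
  \<comment> \<open>A point of the chart already lies on the graph, so there the curve is just a
    nonzero multiple of the point. This identifies its values at \<open>t = 0\<close> and
    \<open>t = 1\<close>.\<close>
  have \<gamma>_eq: "\<gamma> t = (\<lambda>k. dadj i z * z k)" if "z \<in> smooth_chart i" "y t = z" for t z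
  proof -
    have "rest i z = - (z i * dadj i z)"
      using that(1) adj_decomp[OF i, of z] by (simp add: smooth_chart_def add_eq_0_iff)
    then show ?thesis using that(2) by (auto simp: \<gamma>_def)
  qed
  have "\<gamma> 0 = (\<lambda>k. dadj i p * p k)" "\<gamma> 1 = (\<lambda>k. dadj i q * q k)"
    by (rule \<gamma>_eq[OF p(1)], simp add: y_def, rule \<gamma>_eq[OF q(1)], simp add: y_def)
  then have ne: "f (\<gamma> 0) \<noteq> 0" "g (\<gamma> 1) \<noteq> 0"
    using homogeneous_poly_scale[OF f, of "dadj i p" p] homogeneous_poly_scale[OF g, of "dadj i q" q]
      p q by (auto simp: smooth_chart_def)
  have d0: "dadj i (y 0) \<noteq> 0" using p(1) by (simp add: y_def smooth_chart_def)
  \<comment> \<open>The three polynomials in \<open>t\<close> are nonzero at 0, 1 and 0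
    respectively, so each has finitely many roots and a common good parameter exists.\<close>
  define bad where "bad = {t. f (\<gamma> t) = 0} \<union> {t. g (\<gamma> t) = 0} \<union> {t. dadj i (y t) = 0}"
  have "finite {t. f (\<gamma> t) = 0}"
    by (rule finite_zeros_poly_fun[of "\<lambda>t. f (\<gamma> t)", OF _ ne(1)], rule poly_fun_homogeneous_poly[OF f], rule poly\<gamma>)
  moreover have "finite {t. g (\<gamma> t) = 0}"
    by (rule finite_zeros_poly_fun[of "\<lambda>t. g (\<gamma> t)", OF _ ne(2)], rule poly_fun_homogeneous_poly[OF g], rule poly\<gamma>)
  ultimately have "finite bad"
    unfolding bad_def using finite_zeros_poly_fun[OF polyd d0] by (simp only: finite_Un)
  then obtain t where "t \<notin> bad"
    using ex_new_if_finite[OF infinite_UNIV_char_0] by metis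
  then have t: "f (\<gamma> t) \<noteq> 0" "g (\<gamma> t) \<noteq> 0" "dadj i (y t) \<noteq> 0"
    by (simp_all add: bad_def)
  have "\<gamma> t \<in> smooth_chart i" using t(3) by (simp add: smooth_chart_def adj_\<gamma> dadj_\<gamma>)
  from fg[OF this] t(1,2) show False by simp
qed

text \<open>On chart \<open>j\<close> the product \<open>f * dadj i\<close> vanishes, because
  \<open>f\<close> vanishes wherever \<open>dadj i\<close> does not. By irreducibility one factor
  vanishes on the chart, and it is not \<open>dadj i\<close>, which is nonzero at
  \<open>x0\<close>.\<close>

lemma smooth_chart_transfer:
  assumes i: "i \<in> R" and j: "j \<in> R" and x0: "x0 \<in> smooth_chart i" "x0 \<in> smooth_chart j"
    and f: "homogeneous_poly R k f" and fi: "\<And>x. x \<in> smooth_chart i \<Longrightarrow> f x = 0"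
    and x: "x \<in> smooth_chart j"
  shows "f x = 0"
proof -
  have "f y * dadj i y = 0" if "y \<in> smooth_chart j" for y
    using fi[of y] that by (auto simp: smooth_chart_def)
  from smooth_chart_irreducible[OF j f homogeneous_poly_dadj[OF i] this]
  show ?thesis using x x0 by (auto simp: smooth_chart_def)
qed

text \<open>The vector with 0 at \<open>i\<close> and \<open>j\<close> and 1 elsewhere works: by
  \<open>dadj_nonadj\<close> the two derivatives are sums of two positive weights.\<close>

lemma nonadj_smooth_charts_meet:
  assumes ij: "nonadj i j"
  shows "\<exists>x. x \<in> smooth_chart i \<and> x \<in> smooth_chart j"
proof -
  define x :: "nat \<Rightarrow> complex" where "x = (\<lambda>k. if k = i \<or> k = j then 0 else 1)"
  have x0: "x i = 0" "x j = 0" by (auto simp: x_def)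
  have "dadj k x \<noteq> 0" if kl: "nonadj k l" "{k, l} = {i, j}" for k l
  proof -
    have l: "x l = 0" using kl(2) x0 by (metis insertCI insertE singletonD)
    have one: "x m = 1" if "m \<noteq> k" "m \<noteq> l" for m using that kl(2) unfolding x_def by auto
    have "edge_form l x = of_real (a (pr l) + a l)"
      using nonadj[OF kl(1)] cyc[of l] one by (simp add: edge_form_def)
    moreover have "a (pr l) + a l > 0"
      using nonadj(2)[OF kl(1)] cyc(2) a_pos by (simp add: add_pos_pos)
    moreover have "(\<Prod>m\<in>R - {k, l, pr l, sc l}. x m) = 1" by (rule prod.neutral) (use one in auto)
    ultimately show ?thesis
      using dadj_nonadj[of k l x, OF kl(1) l] by (simp del: of_real_add)
  qed
  from this[OF ij] this[OF nonadj_sym[OF ij]] show ?thesis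
    using adj_nonadj[OF ij x0] by (auto simp: smooth_chart_def intro!: exI[of _ x])
qed

text \<open>Vanishing spreads between charts of nonadjacent indices. For \<open>n \<ge> 5\<close>
  the complement of the cycle is connected. For \<open>n = 4\<close> it has the components 1, 3 and
  2, 4, which genericity links by an extra point. For \<open>n = 3\<close> chart 1 is the whole zero
  set of \<open>adj\<close>.\<close>

lemma smooth_charts_vanishing:
  assumes f: "homogeneous_poly R k f" and f1: "\<And>x. x \<in> smooth_chart 1 \<Longrightarrow> f x = 0"
    and j: "j \<in> R" and x: "x \<in> smooth_chart j"
  shows "f x = 0"
proof -
  have step: "\<forall>x\<in>smooth_chart l. f x = 0" if ml: "nonadj m l" "\<forall>x\<in>smooth_chart m. f x = 0" for m l
  proof -
    obtain x0 where "x0 \<in> smooth_chart m" "x0 \<in> smooth_chart l"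
      using nonadj_smooth_charts_meet[OF ml(1)] by blast
    then show ?thesis
      using smooth_chart_transfer[OF nonadj(1,2)[OF ml(1)] _ _ f] ml(2) by blast
  qed
  have f1': "\<forall>x\<in>smooth_chart 1. f x = 0" using f1 by blast
  consider "n = 3" | "n = 4" | "n \<ge> 5" using n3 by linarith
  then have "\<forall>x\<in>smooth_chart j. f x = 0"
  proof cases
    case 1
    have "smooth_chart j \<subseteq> smooth_chart 1"
    proof -
      \<comment> \<open>For a triangle the derivative is the constant \<open>a 2\<close>.\<close>
      have "dadj 1 x \<noteq> 0" for x
      proof -
        have "R - {pr 1, 1} = {2}" using 1 by (auto simp: cyc_pred_def)
        moreover have "R - {1, 2, sc 2} = {}" using 1 by (auto simp: cyc_succ_def)
        ultimately have "dadj 1 x = (\<Sum>k\<in>{2}. of_real (a k) * (\<Prod>l\<in>R - {1, k, sc k}. x l))"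
          "(\<Prod>l\<in>R - {1, 2, sc 2}. x l) = 1"
          by (simp_all only: dadj_def prod.empty)
        then have "dadj 1 x = of_real (a 2)" by simp
        then show ?thesis using a_pos[of 2] 1 by simp
      qed
      then show ?thesis by (auto simp: smooth_chart_def)
    qed
    then show ?thesis using f1' by blast
  next
    case 2
    note v = 2 cyc_succ_def cyc_pred_def
    \<comment> \<open>With \<open>x 1 = 0\<close>, membership in the hypersurface amounts to
      \<open>a 4 * x 2 + a 1 * x 4 = 0\<close> or \<open>x 3 = 0\<close>; the first is solved here
      with \<open>x 3\<close> nonzero.\<close>
    define x :: "nat \<Rightarrow> complex" where
      "x = (\<lambda>_. 0)(2 := of_real (a 1), 3 := 1, 4 := - of_real (a 4))"
    have x: "x 1 = 0" "x 2 = of_real (a 1)" "x 3 = 1" "x 4 = - of_real (a 4)"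
      by (auto simp: x_def)
    have R4: "R = {1, 2, 3, 4}" using 2 [[linarith_neq_limit = 9]] by auto
    have mem: "1 \<in> R" "2 \<in> R" "4 \<in> R" using 2 by auto
    have nbs: "pr 1 = 4" "sc 1 = 2" by (auto simp: v)
    have "edge_form 1 x = 0" unfolding edge_form_def nbs x by (simp add: mult.commute)
    then have "adj x = 0" using adj_decomp[OF mem(1), of x] x(1) by (simp add: rest_def)
    moreover have "dadj 2 x \<noteq> 0"
    proof -
      have "R - {4, 1, 2} = {3}" unfolding R4 by auto
      then have "dadj 2 x = of_real (a 4) * (\<Prod>l\<in>{3}. x l)"
        using dadj_succ_eq[of 1 x, unfolded nbs, OF mem(1) x(1)] by (simp only:)
      then show ?thesis using a_pos[OF mem(3)] by (simp add: x)
    qed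
    moreover have "dadj 1 x \<noteq> 0"
    proof -
      have "R - {4, 1} = {2, 3}" "R - {1, 2, sc 2} = {4}" "R - {1, 3, sc 3} = {2}"
        unfolding R4 by (auto simp: v)
      then have "(\<Prod>l\<in>R - {1, 2, sc 2}. x l) = x 4" "(\<Prod>l\<in>R - {1, 3, sc 3}. x l) = x 2"
        "dadj 1 x = (\<Sum>k\<in>{2, 3}. of_real (a k) * (\<Prod>l\<in>R - {1, k, sc k}. x l))"
        by (simp_all only: dadj_def nbs) simp_all
      then have "dadj 1 x = of_real (a 1 * a 3 - a 2 * a 4)"
        by (simp add: x)
      \<comment> \<open>This is exactly the genericity condition for \<open>n = 4\<close>.\<close>
      moreover have "a 1 * a 3 \<noteq> a 2 * a 4"
      proof -
        have "{1..2::nat} = {1, 2}" by auto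
        then show ?thesis using generic 2 by (simp add: mult.commute)
      qed
      ultimately show ?thesis by (simp del: of_real_mult of_real_diff)
    qed
    ultimately have x12: "x \<in> smooth_chart 1" "x \<in> smooth_chart 2"
      by (auto simp: smooth_chart_def)
    have c2: "\<forall>x\<in>smooth_chart 2. f x = 0"
      using smooth_chart_transfer[of 1 2, OF _ _ x12 f] f1' 2 by auto
    have "nonadj 1 3" "nonadj 2 4" unfolding nonadj_def cyc_succ_def using 2 by auto
    then have "\<forall>x\<in>smooth_chart 3. f x = 0" "\<forall>x\<in>smooth_chart 4. f x = 0"
      using step f1' c2 by blast+
    moreover have "j \<in> {1, 2, 3, 4}" using j unfolding R4 .
    ultimately show ?thesis using f1' c2 by auto
  next
    case 3
    have "j = 1 \<or> j = 2 \<or> j = n \<or> nonadj 1 j"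
      using j 3 unfolding nonadj_def cyc_succ_def by (cases "j = n") auto
    then consider "j = 1" | "j = 2" | "j = n" | "nonadj 1 j" by blast
    then show ?thesis
    proof cases
      assume "j = 1" then show ?thesis using f1' by simp
    next
      assume "j = 2"
      moreover have "nonadj 1 4" "nonadj 4 2" unfolding nonadj_def cyc_succ_def using 3 by auto
      ultimately show ?thesis using step f1' by blast
    next
      assume "j = n"
      moreover have "nonadj 1 3" "nonadj 3 n" unfolding nonadj_def cyc_succ_def using 3 by auto
      ultimately show ?thesis using step f1' by blast
    next
      assume "nonadj 1 j" then show ?thesis using step f1' by blast
    qed
  qed
  then show ?thesis using x by blast
qed

text \<open>
  A singular point \<open>x\<close> has two zero coordinates \<open>i\<close> and \<open>j\<close> that are not adjacent; adding the same
  small number to all other coordinates gives smooth points of the hypersurface.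
\<close>

lemma vanishing_on_smooth_imp_vanishing:
  assumes f: "homogeneous_poly R k f"
    and smooth: "\<And>j x. j \<in> R \<Longrightarrow> x \<in> smooth_chart j \<Longrightarrow> f x = 0"
    and x: "adj x = 0"
  shows "f x = 0"
proof (cases "\<exists>i\<in>R. dadj i x \<noteq> 0")
  case True
  then show ?thesis using smooth x by (auto simp: smooth_chart_def)
next
  case False
  then obtain i j where ij: "nonadj i j" "x i = 0" "x j = 0"
    using singular_imp_nonadj_zeros[of x] by blast
  define y where "y = (\<lambda>t k. if k = i \<or> k = j then 0 else x k + t)"
  have y0: "y t i = 0" "y t j = 0" for t by (auto simp: y_def)
  have j: "j \<in> R" "pr j \<noteq> i" "pr j \<noteq> j" "sc j \<noteq> i" "sc j \<noteq> j" "pr j \<in> R"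
    using nonadj[OF ij(1)] cyc[of j] by auto
  \<comment> \<open>The slope in \<open>t\<close> of \<open>edge_form j (y t)\<close>, positive as a
    sum of two weights.\<close>
  define s where "s = complex_of_real (a (pr j) + a j)"
  have s: "s \<noteq> 0"
    using a_pos[OF j(1)] a_pos[OF j(6)] unfolding s_def of_real_eq_0_iff by linarith
  \<comment> \<open>The excluded parameters are those at which a coordinate \<open>x k + t\<close>
    or the edge form at \<open>j\<close> vanishes.\<close>
  have "dadj i (y t) \<noteq> 0" if t: "t \<notin> (\<lambda>k. - x k) ` R \<union> {- edge_form j x / s}" for t
  proof -
    have "edge_form j (y t) = edge_form j x + t * s"
      using j by (simp add: edge_form_def y_def s_def algebra_simps)
    moreover have "t \<noteq> - edge_form j x / s" using t by blast
    ultimately have "edge_form j (y t) \<noteq> 0"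
      using s by (metis add_eq_0_iff nonzero_eq_divide_eq)
    moreover have "y t m \<noteq> 0" if "m \<in> R - {i, j, pr j, sc j}" for m
    proof -
      have "t \<noteq> - x m" using t that by blast
      then show ?thesis using that by (simp add: y_def add_eq_0_iff)
    qed
    ultimately show ?thesis
      using dadj_nonadj[of i j "y t", OF ij(1) y0(2)] by simp
  qed
  then have "f (y t) = 0" if t: "t \<notin> (\<lambda>k. - x k) ` R \<union> {- edge_form j x / s}" for t
    using smooth[OF nonadj(1)[OF ij(1)], of "y t"] adj_nonadj[OF ij(1) y0] t
    by (auto simp: smooth_chart_def)
  \<comment> \<open>A polynomial in \<open>t\<close> that is nonzero for only finitely many
    parameters is zero, in particular at \<open>t = 0\<close>, where \<open>y t\<close> is
    \<open>x\<close>.\<close>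
  then have "{t. f (y t) \<noteq> 0} \<subseteq> (\<lambda>k. - x k) ` R \<union> {- edge_form j x / s}" by blast
  then have "finite {t. f (y t) \<noteq> 0}" by (rule finite_subset) simp
  moreover have "poly_fun (\<lambda>t. f (y t))"
  proof (rule poly_fun_homogeneous_poly[OF f])
    show "poly_fun (\<lambda>t. y t m)" for m
      by (cases "m = i \<or> m = j") (auto simp: y_def)
  qed
  ultimately have "f (y 0) = 0" by (rule poly_fun_eq_0[rotated])
  moreover have "y 0 = x" using ij(2,3) by (auto simp: y_def)
  ultimately show ?thesis by simp
qed

text \<open>Chart 1 decides which factor vanishes; linked charts carry this to all smooth points,
  and the deformation above to the singular ones.\<close>

lemma adj_prime:
  assumes f: "homogeneous_poly R k f" and g: "homogeneous_poly R l g"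
    and fg: "\<And>x. adj x = 0 \<Longrightarrow> f x * g x = 0"
  shows "(\<forall>x. adj x = 0 \<longrightarrow> f x = 0) \<or> (\<forall>x. adj x = 0 \<longrightarrow> g x = 0)"
proof -
  have 1: "(1::nat) \<in> R" using n3 by simp
  have "(\<forall>x\<in>smooth_chart 1. f x = 0) \<or> (\<forall>x\<in>smooth_chart 1. g x = 0)"
    by (rule smooth_chart_irreducible[OF 1 f g]) (rule fg, simp add: smooth_chart_def)
  then show ?thesis
  proof
    assume "\<forall>x\<in>smooth_chart 1. f x = 0"
    then show ?thesis
      using smooth_charts_vanishing[OF f] vanishing_on_smooth_imp_vanishing[OF f] by blast
  next
    assume "\<forall>x\<in>smooth_chart 1. g x = 0"
    then show ?thesis
      using smooth_charts_vanishing[OF g] vanishing_on_smooth_imp_vanishing[OF g] by blast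
  qed
qed

end

section \<open>Irreducibility in projective space\<close>

context generic_cyclic_adjoint
begin

lemma irreducible_adj: "zariski_irreducible R (proj_zeros R {adj})"
  unfolding zariski_irreducible_def
proof (intro conjI allI impI)
  have 1: "1 \<in> R" using n3 by simp
  define y :: "nat \<Rightarrow> complex" where "y = (\<lambda>k. if k \<in> R then 1 else 0)"
  \<comment> \<open>The equation \<open>adj x = 0\<close> is solved for the first coordinate, with
    all others equal to 1; there \<open>dadj 1\<close> is a sum of positive weights.\<close>
  define x where "x = y(1 := - rest 1 y / dadj 1 y)"
  have "dadj 1 y = of_real (\<Sum>k\<in>R - {pr 1, 1}. a k)"
    unfolding dadj_def of_real_sum by (rule sum.cong[OF refl]) (auto simp: y_def intro!: prod.neutral)
  moreover have "(\<Sum>k\<in>R - {pr 1, 1}. a k) > 0"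
  proof (rule sum_pos)
    have "2 \<in> R - {pr 1, 1}" using n3 by (auto simp: cyc_pred_def)
    then show "R - {pr 1, 1} \<noteq> {}" by blast
  qed (use a_pos in auto)
  ultimately have "dadj 1 y \<noteq> 0" by (simp del: of_real_sum)
  moreover have "dadj 1 x = dadj 1 y" by (rule dadj_cong) (simp add: x_def)
  moreover have "rest 1 x = rest 1 y" by (rule rest_cong[OF 1]) (simp add: x_def)
  ultimately have "adj x = 0" using adj_decomp[OF 1, of x] by (simp add: x_def)
  moreover have x: "\<forall>i. i \<notin> R \<longrightarrow> x i = 0" "\<exists>i\<in>R. x i \<noteq> 0"
    using n3 by (auto simp: x_def y_def intro!: bexI[of _ 2])
  ultimately have "proj_point x \<in> proj_zeros R {adj}"
    using homogeneous_poly_scale[OF homogeneous_poly_adj]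
    by (auto simp: proj_zeros_def proj_space_def proj_point_def)
  then show "proj_zeros R {adj} \<noteq> {}" by blast
next
  fix X Y
  assume "zariski_closed R X \<and> zariski_closed R Y \<and> proj_zeros R {adj} \<subseteq> X \<union> Y"
  then have closed: "zariski_closed R X" "zariski_closed R Y" and sub: "proj_zeros R {adj} \<subseteq> X \<union> Y"
    by auto
  obtain \<F> where \<F>: "\<forall>f\<in>\<F>. \<exists>k. homogeneous_poly R k f" "X = proj_zeros R \<F>"
    using closed(1) unfolding zariski_closed_def by auto
  obtain \<G> where \<G>: "\<forall>g\<in>\<G>. \<exists>k. homogeneous_poly R k g" "Y = proj_zeros R \<G>"
    using closed(2) unfolding zariski_closed_def by auto
  show "proj_zeros R {adj} \<subseteq> X \<or> proj_zeros R {adj} \<subseteq> Y"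
  proof (rule ccontr)
    assume "\<not> ?thesis"
    then obtain p q where p: "p \<in> proj_zeros R {adj}" "p \<notin> X"
      and q: "q \<in> proj_zeros R {adj}" "q \<notin> Y" by blast
    obtain f x where f: "f \<in> \<F>" "x \<in> p" "f x \<noteq> 0"
      using p unfolding \<F>(2) proj_zeros_def by auto
    obtain g y where g: "g \<in> \<G>" "y \<in> q" "g y \<noteq> 0"
      using q unfolding \<G>(2) proj_zeros_def by auto
    obtain k where hf: "homogeneous_poly R k f" using \<F>(1) f(1) by blast
    obtain l where hg: "homogeneous_poly R l g" using \<G>(1) g(1) by blast
    have adjx: "adj x = 0" and adjy: "adj y = 0"
      using proj_zerosD[OF p(1) _ f(2)] proj_zerosD[OF q(1) _ g(2)] by auto
    have nonzero: "f z * g z = 0" if z: "adj z = 0" "\<exists>i\<in>R. z i \<noteq> 0" for z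
    proof -
      \<comment> \<open>Representatives of projective points are 0 outside \<open>R\<close>, whereas
        \<open>adj_prime\<close> ranges over all vectors; truncation changes none of the
        forms.\<close>
      define w where "w = (\<lambda>i. if i \<in> R then z i else 0)"
      have w: "adj w = adj z" "f w = f z" "g w = g z"
        using homogeneous_poly_cong[OF homogeneous_poly_adj, of w z]
          homogeneous_poly_cong[OF hf, of w z] homogeneous_poly_cong[OF hg, of w z]
        by (auto simp: w_def)
      have "proj_point w \<in> proj_space R"
        unfolding proj_space_def
      proof (intro CollectI exI[of _ w] conjI refl)
        show "\<forall>i. i \<notin> R \<longrightarrow> w i = 0" by (simp add: w_def)
        show "\<exists>i\<in>R. w i \<noteq> 0" using z(2) unfolding w_def by (metis (no_types, lifting))
      qed
      then have "proj_point w \<in> proj_zeros R {adj}"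
        using homogeneous_poly_scale[OF homogeneous_poly_adj, of _ w] w(1) z(1)
        by (auto simp: proj_zeros_def proj_point_def)
      moreover have "w \<in> proj_point w"
        unfolding proj_point_def by (rule CollectI, rule exI[of _ 1]) simp
      ultimately have "f w = 0 \<or> g w = 0"
        using sub proj_zerosD f(1) g(1) unfolding \<F>(2) \<G>(2) by blast
      then show ?thesis using w by auto
    qed
    have "f z * g z = 0" if z: "adj z = 0" for z
    proof (cases "\<exists>i\<in>R. z i \<noteq> 0")
      case True
      then show ?thesis using nonzero z by blast
    next
      case False
      \<comment> \<open>The zero vector is no projective point. There the product of the two forms
        is \<open>0 ^ (k + l)\<close> times its value at the representative \<open>v\<close> of a
        point of the hypersurface, and that value is 0; this also covers degree 0.\<close>
      obtain v where v: "p = proj_point v" "\<exists>i\<in>R. v i \<noteq> 0"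
        using p(1) unfolding proj_zeros_def proj_space_def by auto
      have "v \<in> p" unfolding v(1) proj_point_def by (rule CollectI, rule exI[of _ 1]) simp
      then have "adj v = 0" using proj_zerosD[OF p(1)] by auto
      have "f z * g z = f (\<lambda>i. 0 * v i) * g (\<lambda>i. 0 * v i)"
        using homogeneous_poly_cong[OF homogeneous_poly_mult[OF hf hg], of z "\<lambda>i. 0 * v i"] False
        by auto
      also have "\<dots> = 0 ^ (k + l) * (f v * g v)"
        by (rule homogeneous_poly_scale[OF homogeneous_poly_mult[OF hf hg]])
      also have "f v * g v = 0" using nonzero \<open>adj v = 0\<close> v(2) by blast
      finally show ?thesis by simp
    qed
    from adj_prime[OF hf hg this] show False using f(3) g(3) adjx adjy by blast
  qed
qed

section \<open>Linear pieces covering the singular locus\<close>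

definition sing :: "(nat \<Rightarrow> complex) set set" where
  "sing = proj_zeros R (dadj ` R)"

lemma sing_obtain_nonadj:
  assumes "p \<in> sing" "x \<in> p"
  shows "\<exists>i j. nonadj i j \<and> x i = 0 \<and> x j = 0"
  by (rule singular_imp_nonadj_zeros) (use proj_zerosD[OF assms(1)[unfolded sing_def] _ assms(2)] in auto)

text \<open>
  With \<open>k = sc j\<close> this is the zero set of \<open>x i\<close>, \<open>x j\<close> and \<open>edge_form j\<close>; the other values of \<open>k\<close>
  come from the remaining linear factors of \<open>dadj i\<close>.
\<close>

definition linear_piece :: "nat \<times> nat \<times> nat \<Rightarrow> (nat \<Rightarrow> complex) set set" where
  "linear_piece = (\<lambda>(i, j, k). proj_zeros R {\<lambda>x. x i, \<lambda>x. x j, if k = sc j then edge_form j else (\<lambda>x. x k)})"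

definition pieces :: "(nat \<times> nat \<times> nat) set" where
  "pieces = {(i, j, k). nonadj i j \<and> k \<in> R - {i, j}}"

lemma finite_pieces: "finite pieces"
  by (rule finite_subset[of _ "R \<times> R \<times> R"]) (auto simp: pieces_def nonadj_def)

lemma homogeneous_poly_linear_piece:
  assumes "(i, j, k) \<in> pieces" "f \<in> {\<lambda>x. x i, \<lambda>x. x j, if k = sc j then edge_form j else (\<lambda>x. x k)}"
  shows "homogeneous_poly R 1 f"
  using assms homogeneous_poly_var[of R] homogeneous_poly_edge_form
  by (auto simp: pieces_def nonadj_def split: if_splits simp del: atLeastAtMost_iff)

lemma zariski_closed_linear_piece:
  assumes "t \<in> pieces"
  shows "zariski_closed R (linear_piece t)"
proof -
  obtain i j k where t: "t = (i, j, k)" by (cases t)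
  show ?thesis
    unfolding t linear_piece_def prod.case
    by (rule zariski_closed_proj_zeros, rule exI, rule homogeneous_poly_linear_piece[OF assms[unfolded t]])
qed

text \<open>At two nonadjacent zeros \<open>i\<close>, \<open>j\<close> the derivative
  \<open>dadj i\<close> is a product of linear forms, so its vanishing adds a third linear
  equation.\<close>

lemma sing_subset_pieces: "sing \<subseteq> (\<Union>t\<in>pieces. linear_piece t)"
proof
  fix p assume p: "p \<in> sing"
  then have ps: "p \<in> proj_space R" by (simp add: sing_def proj_zeros_def)
  then obtain x where "p = proj_point x" unfolding proj_space_def by auto
  then have xp: "x \<in> p" unfolding proj_point_def by (auto intro!: exI[of _ 1])
  obtain i j where ij: "nonadj i j" "x i = 0" "x j = 0" using sing_obtain_nonadj[OF p xp] by blast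
  note c = nonadj[OF ij(1)] cyc[OF nonadj(2)[OF ij(1)]]
  have "dadj i x = 0"
    using proj_zerosD[OF p[unfolded sing_def] _ xp] c(1) by auto
  then have "edge_form j x = 0 \<or> (\<exists>k\<in>R - {i, j, pr j, sc j}. x k = 0)"
    using dadj_nonadj[of i j x, OF ij(1,3)] by auto
  then obtain k where k: "k \<in> R - {i, j}" "(if k = sc j then edge_form j else (\<lambda>x. x k)) x = 0"
  proof
    assume "edge_form j x = 0"
    \<comment> \<open>The index \<open>sc j\<close> encodes the factor \<open>edge_form j\<close>,
      as \<open>sc j\<close> is not among the indices of the other factors.\<close>
    moreover have "sc j \<in> R - {i, j}" using c by auto
    ultimately show ?thesis using that[of "sc j"] by simp
  next
    assume "\<exists>k\<in>R - {i, j, pr j, sc j}. x k = 0"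
    then obtain k where "k \<in> R - {i, j, pr j, sc j}" "x k = 0" by blast
    then show ?thesis using that[of k] by simp
  qed
  have t: "(i, j, k) \<in> pieces" using ij(1) k(1) by (simp add: pieces_def)
  have "f y = 0" if y: "y \<in> p"
    and f: "f \<in> {\<lambda>x. x i, \<lambda>x. x j, if k = sc j then edge_form j else (\<lambda>x. x k)}" for f y
  proof -
    have "f x = 0" using f ij(2,3) k(2) by auto
    then show ?thesis by (rule homogeneous_poly_zero_cong[OF homogeneous_poly_linear_piece[OF t f] ps xp y])
  qed
  then have "p \<in> linear_piece (i, j, k)"
    using ps unfolding linear_piece_def proj_zeros_def prod.case by (intro CollectI conjI ballI)
  then show "p \<in> (\<Union>t\<in>pieces. linear_piece t)" using t by blast
qed

text \<open>The top of a chain is irreducible, hence inside one linear piece. Three coordinates are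
  eliminated there, so \<open>n - 3\<close> homogeneous coordinates remain and the chain has length
  at most \<open>n - 4\<close>.\<close>

lemma zariski_dim_sing_le: "zariski_dim R sing \<le> ereal (real n - 4)"
  unfolding zariski_dim_def
proof (rule Sup_least, safe)
  \<comment> \<open>For \<open>n = 3\<close> the bound equals -1, the value for the empty
    set.\<close>
  show "- 1 \<le> ereal (real n - 4)"
  proof -
    have "ereal (- 1) \<le> ereal (real n - 4)" using n3 by simp
    then show ?thesis by (simp add: one_ereal_def)
  qed
next
  fix r and Z :: "nat \<Rightarrow> (nat \<Rightarrow> complex) set set"
  assume Z: "\<forall>i\<le>r. zariski_closed R (Z i) \<and> zariski_irreducible R (Z i) \<and> Z i \<subseteq> sing"
    and chain: "\<forall>i<r. Z i \<subset> Z (Suc i)"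
  have "Z r \<subseteq> (\<Union>t\<in>pieces. linear_piece t)" using Z sing_subset_pieces by blast
  then obtain t where t: "t \<in> pieces" "Z r \<subseteq> linear_piece t"
    using irreducible_subset_UN[of R "Z r" pieces linear_piece] Z finite_pieces zariski_closed_linear_piece
    by blast
  obtain i j k where ijk: "t = (i, j, k)" by (cases t)
  have ij: "nonadj i j" and k: "k \<in> R" "k \<noteq> i" "k \<noteq> j" using t(1) by (auto simp: ijk pieces_def)
  note c = nonadj[OF ij] cyc[OF nonadj(2)[OF ij]]
  define R' where "R' = R - {i, j, k}"
  have cardR': "card R' = n - 3" unfolding R'_def using c(1-3) k by (intro card_diff3) auto
  \<comment> \<open>Nonadjacent indices exist only from the quadrilateral on; this keeps the
    subtraction \<open>n - 4\<close> of naturals exact.\<close>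
  have n4: "4 \<le> n"
  proof (rule ccontr)
    assume "\<not> 4 \<le> n"
    then have "n = 3" using n3 by simp
    then have "i \<in> {1, 2, 3}" "j \<in> {1, 2, 3}" using c(1,2) by auto
    then show False using c(3-5) \<open>n = 3\<close> unfolding cyc_succ_def by auto
  qed
  then obtain r0 where r0: "r0 \<in> R'" using cardR' by fastforce
  \<comment> \<open>An eliminated coordinate is expressed by one in \<open>R'\<close>. If
    \<open>k = sc j\<close>, the edge form gives \<open>x k\<close> as a multiple of
    \<open>x (pr j)\<close>; the vanishing coordinates get the factor 0, with \<open>r0\<close> as a
    default target.\<close>
  define s where "s = (\<lambda>m. if m \<in> R' then m else if m = sc j then pr j else r0)"
  define l :: "nat \<Rightarrow> complex" where
    "l = (\<lambda>m. if m \<in> R' then 1 else if m = k \<and> k = sc j then - of_real (a j / a (pr j)) else 0)"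
  have "r \<le> n - 4"
  proof (rule irreducible_chain_length_le[of R R' "n - 4" s "linear_piece t" l r Z])
    show "finite R" "finite R'" by (auto simp: R'_def)
    show "card R' = Suc (n - 4)" using cardR' n4 by simp
    show "s m \<in> R'" if "m \<in> R" for m
    proof (cases "m \<in> R' \<or> m \<noteq> sc j")
      case True
      then show ?thesis using r0 by (auto simp: s_def)
    next
      case False
      then have "sc j \<notin> R'" "m = sc j" by auto
      then have "k = sc j" using c(1-15) unfolding R'_def by blast
      then have "pr j \<in> R'" using c(1-17) unfolding R'_def by blast
      then show ?thesis using False by (simp add: s_def)
    qed
    show "x m = l m * x (s m)" if p: "p \<in> linear_piece t" "x \<in> p" and m: "m \<in> R" for p x m
    proof -
      have lin: "x i = 0" "x j = 0" "(if k = sc j then edge_form j else (\<lambda>x. x k)) x = 0"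
        by (rule proj_zerosD[OF p(1)[unfolded ijk linear_piece_def prod.case] _ p(2)], simp)+
      consider "m \<in> R'" | "m = i" | "m = j" | "m = k" using m unfolding R'_def by blast
      then show ?thesis
      proof cases
        case 1
        then show ?thesis by (simp add: l_def s_def)
      next
        case 2
        then have "l m = 0" using k(2) by (auto simp: l_def R'_def)
        then show ?thesis using lin 2 by simp
      next
        case 3
        then have "l m = 0" using k(3) by (auto simp: l_def R'_def)
        then show ?thesis using lin 3 by simp
      next
        case 4
        then have mR: "m \<notin> R'" by (simp add: R'_def)
        show ?thesis
        proof (cases "k = sc j")
          case True
          have "a (pr j) > 0" using a_pos c by blast
          moreover have "of_real (a (pr j)) * x k = - (of_real (a j) * x (pr j))"
            using lin(3) True by (simp add: edge_form_def add_eq_0_iff2)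
          ultimately have "x k = - of_real (a j / a (pr j)) * x (pr j)"
            by (simp add: field_simps)
          then show ?thesis using 4 True mR by (simp add: l_def s_def)
        next
          case False
          then show ?thesis using lin(3) 4 mR by (simp add: l_def)
        qed
      qed
    qed
  qed (use Z chain t(2) in auto)
  then show "ereal (real r) \<le> ereal (real n - 4)" using n4 by simp
qed

end

section \<open>Cones in the plane\<close>

lemma convex_cone_hull_single: "convex_cone hull {a} = {t *\<^sub>R a |t. 0 \<le> t}"
  by (simp add: convex_cone_hull_separate_nonempty conic_hull_explicit)

lemma convex_cone_hull_pair:
  "convex_cone hull {a, b} = {s *\<^sub>R a + t *\<^sub>R b |s t. 0 \<le> s \<and> 0 \<le> t}"
proof -
  have "convex_cone hull {a, b} = convex_cone hull ({a} \<union> {b})" by (simp add: insert_commute)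
  then show ?thesis
    unfolding convex_cone_hull_Un convex_cone_hull_single by blast
qed

lemma span_convex_cone_hull: "span (convex_cone hull S) = span S"
proof (rule subset_antisym)
  have "convex_cone hull S \<subseteq> span S"
    by (rule hull_minimal) (rule span_superset, rule convex_cone_span)
  then show "span (convex_cone hull S) \<subseteq> span S"
    by (rule span_minimal[OF _ subspace_span])
  show "span S \<subseteq> span (convex_cone hull S)"
    by (rule span_mono[OF hull_subset])
qed

lemma dim_convex_cone_hull: "dim (convex_cone hull S) = dim S"
  by (metis span_convex_cone_hull dim_span)

lemma convex_cone_hull_single_eq:
  assumes "c \<noteq> 0" "c \<in> convex_cone hull {a}"
  shows "convex_cone hull {c} = convex_cone hull {a}"
proof -
  obtain t where t: "c = t *\<^sub>R a" "0 \<le> t" using assms(2) by (auto simp: convex_cone_hull_single)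
  with assms(1) have "t \<noteq> 0" by auto
  then have "a = (1 / t) *\<^sub>R c" using t by simp
  then have "a \<in> convex_cone hull {c}" using t(2) by (auto simp: convex_cone_hull_single)
  then have "convex_cone hull {a} \<subseteq> convex_cone hull {c}"
    by (intro hull_minimal convex_cone_convex_cone_hull) simp
  moreover have "convex_cone hull {c} \<subseteq> convex_cone hull {a}"
    using assms(2) by (intro hull_minimal convex_cone_convex_cone_hull) simp
  ultimately show ?thesis by blast
qed

definition det2 :: "real ^ 2 \<Rightarrow> real ^ 2 \<Rightarrow> real" where
  "det2 a b = a $ 1 * b $ 2 - a $ 2 * b $ 1"

lemma det2_swap: "det2 b a = - det2 a b"
  by (simp add: det2_def)

lemma det2_self [simp]: "det2 a a = 0"
  by (simp add: det2_def)

lemma det2_add_scale: "det2 c (s *\<^sub>R a + t *\<^sub>R b) = s * det2 c a + t * det2 c b"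
  by (simp add: det2_def algebra_simps)

lemma det2_cramer:
  assumes "det2 a b \<noteq> 0"
  shows "z = (det2 z b / det2 a b) *\<^sub>R a + (det2 a z / det2 a b) *\<^sub>R b"
proof -
  have "det2 a b * z $ i = det2 z b * a $ i + det2 a z * b $ i" for i
    using exhaust_2[of i] by (auto simp: det2_def algebra_simps)
  then show ?thesis using assms by (simp add: vec_eq_iff field_simps)
qed

lemma dim_pair_2_imp_det2:
  assumes "dim {a, b :: real ^ 2} = 2"
  shows "det2 a b \<noteq> 0"
proof
  assume d: "det2 a b = 0"
  have "\<exists>v. {a, b} \<subseteq> span {v}"
  proof (cases "b = 0")
    case True
    then show ?thesis by (auto intro!: exI[of _ a] simp: span_base span_zero)
  next
    case False
    then obtain j where j: "b $ j \<noteq> 0" by (metis vec_eq_iff zero_index)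
    have "b $ j * a $ i = a $ j * b $ i" for i
      using exhaust_2[of i] exhaust_2[of j] d by (auto simp: det2_def algebra_simps)
    then have "a = (a $ j / b $ j) *\<^sub>R b" using j by (simp add: vec_eq_iff field_simps)
    then have "a \<in> span {b}" by (metis span_base span_scale singletonI)
    then show ?thesis by (auto intro!: exI[of _ b] simp: span_base)
  qed
  then obtain v where "{a, b} \<subseteq> span {v}" by blast
  then have "dim {a, b} \<le> dim {v}" by (rule dim_mono)
  also have "\<dots> \<le> card {v}" by (rule dim_le_card') simp
  finally show False using assms by simp
qed

lemma det2_comb_eq:
  assumes "det2 a b \<noteq> 0" "s *\<^sub>R a + t *\<^sub>R b = s' *\<^sub>R a + t' *\<^sub>R b"
  shows "s = s'" "t = t'"
proof -
  have "det2 a (s *\<^sub>R a + t *\<^sub>R b) = det2 a (s' *\<^sub>R a + t' *\<^sub>R b)"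
    "det2 b (s *\<^sub>R a + t *\<^sub>R b) = det2 b (s' *\<^sub>R a + t' *\<^sub>R b)" using assms(2) by simp_all
  then show "s = s'" "t = t'" using assms(1) by (simp_all add: det2_add_scale det2_swap[of b a])
qed

text \<open>If both coefficients of \<open>c = s *\<^sub>R a + t *\<^sub>R b\<close> were positive,
  \<open>c\<close> would be the midpoint of \<open>(2 * s) *\<^sub>R a\<close> and
  \<open>(2 * t) *\<^sub>R b\<close>. The face would then contain these points, which cannot be
  multiples of \<open>c\<close>.\<close>

lemma ray_face_of_cone_pair:
  assumes d: "det2 a b \<noteq> 0" and c: "c \<noteq> 0"
    and face: "(convex_cone hull {c}) face_of (convex_cone hull {a, b})"
  shows "c \<in> convex_cone hull {a} \<or> c \<in> convex_cone hull {b}"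
proof -
  have cc: "c \<in> convex_cone hull {c}" by (simp add: hull_inc)
  then have "c \<in> convex_cone hull {a, b}" using face_of_imp_subset[OF face] by blast
  then obtain s t where st: "c = s *\<^sub>R a + t *\<^sub>R b" "0 \<le> s" "0 \<le> t"
    by (auto simp: convex_cone_hull_pair)
  consider "s = 0" | "t = 0" | "0 < s" "0 < t" using st by linarith
  then show ?thesis
  proof cases
    case 1
    then show ?thesis using st by (auto simp: convex_cone_hull_single)
  next
    case 2
    then show ?thesis using st by (auto simp: convex_cone_hull_single)
  next
    case 3
    have ne: "(2 * s) *\<^sub>R a \<noteq> (2 * t) *\<^sub>R b"
      using det2_comb_eq(1)[OF d, of "2 * s" 0 0 "2 * t"] 3 by auto
    have "c = (1 - 1 / 2) *\<^sub>R ((2 * s) *\<^sub>R a) + (1 / 2) *\<^sub>R ((2 * t) *\<^sub>R b)"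
      by (simp add: st(1))
    then have "c \<in> open_segment ((2 * s) *\<^sub>R a) ((2 * t) *\<^sub>R b)"
      using ne unfolding in_segment by (intro conjI exI[of _ "1 / 2"]) auto
    moreover have "(2 * s) *\<^sub>R a \<in> convex_cone hull {a, b}" "(2 * t) *\<^sub>R b \<in> convex_cone hull {a, b}"
      using 3 by (simp_all add: convex_cone_hull_mul hull_inc)
    ultimately have "(2 * s) *\<^sub>R a \<in> convex_cone hull {c}"
      using face_ofD[OF face _ _ _ cc] by blast
    then obtain r where r: "(2 * s) *\<^sub>R a = r *\<^sub>R c" by (auto simp: convex_cone_hull_single)
    then have "(2 * s) *\<^sub>R a + 0 *\<^sub>R b = (r * s) *\<^sub>R a + (r * t) *\<^sub>R b"
      by (simp add: st(1) scaleR_right_distrib)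
    from det2_comb_eq[OF d this] 3 show ?thesis by auto
  qed
qed

text \<open>On the cone the coefficient of \<open>b\<close> is nonnegative; if it vanishes inside a
  segment, it vanishes at both ends.\<close>

lemma face_of_cone_pair:
  assumes d: "det2 a b \<noteq> 0"
  shows "(convex_cone hull {a}) face_of (convex_cone hull {a, b})"
  unfolding face_of_def
proof (intro conjI)
  show "convex_cone hull {a} \<subseteq> convex_cone hull {a, b}" by (rule hull_mono) simp
  show "convex (convex_cone hull {a})" by (rule convex_convex_cone_hull)
  have "x \<in> convex_cone hull {a} \<and> y \<in> convex_cone hull {a}"
    if x: "x \<in> convex_cone hull {a, b}" and y: "y \<in> convex_cone hull {a, b}"
      and z: "z \<in> convex_cone hull {a}" and seg: "z \<in> open_segment x y" for x y z
  proof -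
  obtain s t where xs: "x = s *\<^sub>R a + t *\<^sub>R b" "0 \<le> s" "0 \<le> t"
    using x by (auto simp: convex_cone_hull_pair)
  obtain s' t' where ys: "y = s' *\<^sub>R a + t' *\<^sub>R b" "0 \<le> s'" "0 \<le> t'"
    using y by (auto simp: convex_cone_hull_pair)
  obtain r where r: "z = r *\<^sub>R a" using z by (auto simp: convex_cone_hull_single)
  obtain w where w: "0 < w" "w < 1" "z = (1 - w) *\<^sub>R x + w *\<^sub>R y"
    using seg by (auto simp: in_segment)
  have "r *\<^sub>R a + 0 *\<^sub>R b = ((1 - w) * s + w * s') *\<^sub>R a + ((1 - w) * t + w * t') *\<^sub>R b"
    using w(3) unfolding r xs(1) ys(1) by (simp add: algebra_simps)
  from det2_comb_eq(2)[OF d this] have "(1 - w) * t + w * t' = 0" by simp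
  moreover have "0 \<le> (1 - w) * t" "0 \<le> w * t'" using w xs ys by auto
  ultimately have "(1 - w) * t = 0" "w * t' = 0" by linarith+
  then have "t = 0" "t' = 0" using w by auto
  then show ?thesis using xs ys by (auto simp: convex_cone_hull_single)
  qed
  then show "\<forall>x\<in>convex_cone hull {a, b}. \<forall>y\<in>convex_cone hull {a, b}. \<forall>z\<in>convex_cone hull {a}.
      z \<in> open_segment x y \<longrightarrow> x \<in> convex_cone hull {a} \<and> y \<in> convex_cone hull {a}"
    by blast
qed

lemma cone_pair_interior:
  assumes d: "det2 a b \<noteq> 0" and st: "0 < s" "0 < t"
  shows "\<exists>\<epsilon>>0. s *\<^sub>R a + t *\<^sub>R b + \<epsilon> *\<^sub>R z \<in> convex_cone hull {a, b}"
proof -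
  obtain p q where z: "z = p *\<^sub>R a + q *\<^sub>R b" using det2_cramer[OF d, of z] by blast
  \<comment> \<open>Small enough to keep both coefficients nonnegative; adding 1 to the denominators
    avoids division by 0.\<close>
  define \<epsilon> where "\<epsilon> = min (s / (\<bar>p\<bar> + 1)) (t / (\<bar>q\<bar> + 1))"
  have "\<epsilon> > 0" using st by (simp add: \<epsilon>_def)
  have nonneg: "0 \<le> r + \<epsilon> * c" if "\<epsilon> \<le> r / (\<bar>c\<bar> + 1)" for r c
  proof -
    have "\<epsilon> * (\<bar>c\<bar> + 1) \<le> r" using that by (simp add: pos_le_divide_eq)
    moreover have "\<epsilon> * (- c) \<le> \<epsilon> * \<bar>c\<bar>" using \<open>\<epsilon> > 0\<close> by (intro mult_left_mono) auto
    ultimately show ?thesis using \<open>\<epsilon> > 0\<close> by (simp add: distrib_left)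
  qed
  have "0 \<le> s + \<epsilon> * p" "0 \<le> t + \<epsilon> * q"
    by (rule nonneg, simp add: \<epsilon>_def)+
  moreover have "s *\<^sub>R a + t *\<^sub>R b + \<epsilon> *\<^sub>R z = (s + \<epsilon> * p) *\<^sub>R a + (t + \<epsilon> * q) *\<^sub>R b"
    by (simp add: z algebra_simps)
  ultimately show ?thesis using \<open>\<epsilon> > 0\<close> unfolding convex_cone_hull_pair by blast
qed

text \<open>The maximal cones of a normal fan have disjoint interiors.\<close>

lemma normal_cone_eqI:
  assumes "F \<noteq> {}" "F \<subseteq> P" "G \<noteq> {}" "G \<subseteq> P" and w: "w \<in> normal_cone P F"
    and wG: "w \<in> normal_cone P G" and int: "\<And>z. \<exists>\<epsilon>>0. w + \<epsilon> *\<^sub>R z \<in> normal_cone P G"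
  shows "normal_cone P F = normal_cone P G"
proof -
  \<comment> \<open>The functional \<open>w\<close> is minimal on \<open>P\<close> at both
    \<open>x\<close> and \<open>y\<close>. Moving \<open>w\<close> in the direction
    \<open>y - x\<close> keeps \<open>y\<close> minimal but raises its value at \<open>y\<close>
    above that at \<open>x\<close> unless the points coincide. So both faces are the same single
    point.\<close>
  have "x = y" if "x \<in> F" "y \<in> G" for x y
  proof -
    have "w \<bullet> x = w \<bullet> y"
      using w wG that assms(2,4) unfolding normal_cone_def by (auto intro!: antisym)
    moreover obtain \<epsilon> where \<epsilon>: "\<epsilon> > 0" "w + \<epsilon> *\<^sub>R (y - x) \<in> normal_cone P G" using int by blast
    then have "(w + \<epsilon> *\<^sub>R (y - x)) \<bullet> y \<le> (w + \<epsilon> *\<^sub>R (y - x)) \<bullet> x"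
      using that assms(2) unfolding normal_cone_def by blast
    ultimately have "\<epsilon> * ((y - x) \<bullet> (y - x)) \<le> 0"
      by (simp add: inner_add_left inner_diff_right algebra_simps)
    then have "(y - x) \<bullet> (y - x) \<le> 0" using \<epsilon>(1) by (simp add: mult_le_0_iff)
    then show ?thesis using inner_ge_zero[of "y - x"] by (simp add: dual_order.antisym)
  qed
  then have "F = G" using assms(1,3) by (metis (no_types) equals0I subsetI subset_antisym)
  then show ?thesis by simp
qed

text \<open>A polytope is the convex hull of its extreme points, so these have the same affine
  dimension, which is less than their number. For a polygon this gives
  \<open>n \<ge> 3\<close>.\<close>

lemma extreme_points_card_ge:
  fixes P :: "'a::euclidean_space set"
  assumes "polytope P"
  shows "aff_dim P + 1 \<le> int (card {v. v extreme_point_of P})"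
proof -
  have "finite {v. v extreme_point_of P}"
    using assms finite_polyhedron_extreme_points polytope_imp_polyhedron by blast
  moreover have "P = convex hull {v. v extreme_point_of P}"
    using assms by (intro Krein_Milman_Minkowski polytope_imp_compact polytope_imp_convex)
  then have "aff_dim P = aff_dim {v. v extreme_point_of P}" by (metis aff_dim_convex_hull)
  ultimately show ?thesis using aff_dim_le_card[of "{v. v extreme_point_of P}"] by simp
qed

section \<open>Minors\<close>

text \<open>The chosen enumeration of the rows is unknown, but the two possible orders differ only
  in the sign of the determinant.\<close>

lemma abs_minor_2:
  fixes u :: "'i \<Rightarrow> real ^ 2"
  assumes "i \<noteq> j"
  shows "abs_minor u {i, j} = \<bar>det2 (u i) (u j)\<bar>"
proof -
  define f where "f = (SOME f. bij_betw f (UNIV :: 2 set) {i, j})"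
  have "\<exists>f. bij_betw f (UNIV :: 2 set) {i, j}"
    using assms by (intro finite_same_card_bij) auto
  then have "bij_betw f UNIV {i, j}" unfolding f_def by (rule someI_ex)
  then have "f ` UNIV = {i, j}" by (simp add: bij_betw_def)
  then have "{f 1, f 2} = {i, j}" unfolding UNIV_2 by simp
  then have "(f 1 = i \<and> f 2 = j) \<or> (f 1 = j \<and> f 2 = i)" by (auto simp: doubleton_eq_iff)
  then show ?thesis
    unfolding abs_minor_def f_def[symmetric] det_2 by (auto simp: det2_def algebra_simps)
qed

lemma abs_minor_1:
  fixes u :: "'i \<Rightarrow> real ^ 1"
  shows "abs_minor u {i} = \<bar>u i $ 1\<bar>"
proof -
  define f where "f = (SOME f. bij_betw f (UNIV :: 1 set) {i})"
  have "\<exists>f. bij_betw f (UNIV :: 1 set) {i}" by (intro finite_same_card_bij) auto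
  then have "bij_betw f UNIV {i}" unfolding f_def by (rule someI_ex)
  then have "f 1 = i" by (auto simp: bij_betw_def)
  then show ?thesis unfolding abs_minor_def f_def[symmetric] det_1 by simp
qed

section \<open>Normal fans of polygons\<close>

locale polygon_fan =
  fixes P :: "(real ^ 2) set" and n :: nat and \<Sigma> :: "(real ^ 2) set set" and u :: "nat \<Rightarrow> real ^ 2"
  assumes n_ge_3: "3 \<le> n"
    and fan: "\<Sigma> = normal_fan P"
    and ray_matrix: "is_ray_matrix \<Sigma> {1..n} u"
    and cones_2: "cones_of_dim \<Sigma> 2 = (\<lambda>i. convex_cone hull {u i, u (cyc_succ n i)}) ` {1..n}"
begin

definition weight :: "nat \<Rightarrow> real" where
  "weight i = abs_minor u {i, cyc_succ n i}"

definition max_cone :: "nat \<Rightarrow> (real ^ 2) set" where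
  "max_cone i = convex_cone hull {u i, u (cyc_succ n i)}"

lemma cones_2_eq: "cones_of_dim \<Sigma> 2 = max_cone ` {1..n}"
  by (simp add: cones_2 max_cone_def[abs_def])

lemma dim_max_cone: "i \<in> {1..n} \<Longrightarrow> dim (max_cone i) = 2"
  using cones_2_eq by (auto simp: cones_of_dim_def)

lemma max_cone_in_fan: "i \<in> {1..n} \<Longrightarrow> max_cone i \<in> \<Sigma>"
  using cones_2_eq by (auto simp: cones_of_dim_def)

lemma det2_succ: "i \<in> {1..n} \<Longrightarrow> det2 (u i) (u (cyc_succ n i)) \<noteq> 0"
  using dim_max_cone[of i] by (intro dim_pair_2_imp_det2) (simp add: max_cone_def dim_convex_cone_hull)

lemma weight_eq:
  assumes "i \<in> {1..n}"
  shows "weight i = \<bar>det2 (u i) (u (cyc_succ n i))\<bar>"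
proof -
  have "i \<noteq> cyc_succ n i" using assms n_ge_3 by (auto simp: cyc_succ_def)
  then show ?thesis unfolding weight_def by (rule abs_minor_2)
qed

sublocale cyclic_adjoint n weight
  by unfold_locales (use n_ge_3 weight_eq det2_succ in auto)

lemma u_nonzero: "i \<in> R \<Longrightarrow> u i \<noteq> 0"
  using ray_matrix unfolding is_ray_matrix_def by blast

lemma ray_inj: "i \<in> R \<Longrightarrow> j \<in> R \<Longrightarrow> u i \<in> convex_cone hull {u j} \<Longrightarrow> i = j"
proof -
  assume ij: "i \<in> R" "j \<in> R" and "u i \<in> convex_cone hull {u j}"
  then have "convex_cone hull {u i} = convex_cone hull {u j}"
    using convex_cone_hull_single_eq u_nonzero by blast
  then show "i = j"
    using ray_matrix ij unfolding is_ray_matrix_def bij_betw_def inj_on_def by blast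
qed

lemma cones_1: "cones_of_dim \<Sigma> 1 = (\<lambda>i. convex_cone hull {u i}) ` R"
  using ray_matrix unfolding is_ray_matrix_def bij_betw_def by simp

lemma cones_1_dim: "i \<in> R \<Longrightarrow> convex_cone hull {u i} \<in> \<Sigma> \<and> dim (convex_cone hull {u i}) = 1"
  using cones_1 by (auto simp: cones_of_dim_def)

lemma zero_in_cone: "\<sigma> \<in> \<Sigma> \<Longrightarrow> 0 \<in> \<sigma>"
  unfolding fan normal_fan_def normal_cone_def by auto

lemma cone_cases:
  assumes "\<sigma> \<in> \<Sigma>"
  obtains "\<sigma> = {0}" | i where "i \<in> R" "\<sigma> = convex_cone hull {u i}" | i where "i \<in> R" "\<sigma> = max_cone i"
proof -
  have "dim \<sigma> \<le> 2" using dim_subset_UNIV[of \<sigma>] by simp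
  then consider "dim \<sigma> = 0" | "dim \<sigma> = 1" | "dim \<sigma> = 2" by linarith
  then show thesis
  proof cases
    case 1
    then show thesis using that(1) zero_in_cone[OF assms] by auto
  next
    case 2
    then have "\<sigma> \<in> cones_of_dim \<Sigma> 1" using assms by (simp add: cones_of_dim_def)
    then show thesis using that(2) cones_1 by auto
  next
    case 3
    then have "\<sigma> \<in> cones_of_dim \<Sigma> 2" using assms by (simp add: cones_of_dim_def)
    then show thesis using that(3) cones_2_eq by auto
  qed
qed

lemma rays_of_zero: "rays_of R u {0} = {}"
proof -
  have "\<not> (convex_cone hull {u i}) face_of {0}" if "i \<in> R" for i
    using u_nonzero[OF that] face_of_imp_subset[of "convex_cone hull {u i}" "{0}"]
      hull_inc[of "u i" "{u i}" convex_cone] by auto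
  then show ?thesis unfolding rays_of_def by blast
qed

lemma rays_of_ray: "i \<in> R \<Longrightarrow> rays_of R u (convex_cone hull {u i}) = {i}"
proof -
  assume i: "i \<in> R"
  have "k = i" if "k \<in> R" "(convex_cone hull {u k}) face_of (convex_cone hull {u i})" for k
    using face_of_imp_subset[OF that(2)] hull_inc[of "u k" "{u k}" convex_cone] ray_inj[OF that(1) i]
    by blast
  moreover have "(convex_cone hull {u i}) face_of (convex_cone hull {u i})"
    by (simp add: face_of_refl convex_convex_cone_hull)
  ultimately show ?thesis using i unfolding rays_of_def by blast
qed

lemma rays_of_max_cone:
  assumes i: "i \<in> R"
  shows "rays_of R u (max_cone i) = {i, sc i}"
proof -
  note d = det2_succ[OF i]
  have "k \<in> {i, sc i}" if "k \<in> R" "(convex_cone hull {u k}) face_of (max_cone i)" for k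
    using ray_face_of_cone_pair[OF d u_nonzero[OF that(1)]] that(2) ray_inj[OF that(1)] i cyc(1)[OF i]
    unfolding max_cone_def by blast
  moreover have "(convex_cone hull {u i}) face_of (max_cone i)"
    unfolding max_cone_def by (rule face_of_cone_pair[OF d])
  moreover have "(convex_cone hull {u (sc i)}) face_of (max_cone i)"
    using face_of_cone_pair[of "u (sc i)" "u i"] d unfolding max_cone_def by (simp add: det2_swap[of "u i"] insert_commute)
  ultimately show ?thesis using i cyc(1)[OF i] unfolding rays_of_def by blast
qed

lemma pair_inj:
  assumes "i \<in> R" "j \<in> R" "{i, sc i} = {j, sc j}"
  shows "i = j"
proof (rule ccontr)
  assume "i \<noteq> j"
  then have "i = sc j" "sc i = j" using assms(3) by (auto simp: doubleton_eq_iff)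
  then show False using cyc[OF assms(1)] cyc(4)[OF assms(2)] by simp
qed

lemma max_cone_inj: "inj_on max_cone R"
  by (rule inj_onI) (metis pair_inj rays_of_max_cone)

lemma universal_adjoint_eq: "universal_adjoint \<Sigma> R u = adj"
proof
  fix x :: "nat \<Rightarrow> complex"
  have "universal_adjoint \<Sigma> R u x = (\<Sum>\<sigma>\<in>max_cone ` R.
      of_real (abs_minor u (rays_of R u \<sigma>)) * (\<Prod>i\<in>R - rays_of R u \<sigma>. x i))"
    unfolding universal_adjoint_def by (simp add: cones_2_eq)
  also have "\<dots> = (\<Sum>i\<in>R. of_real (abs_minor u (rays_of R u (max_cone i))) * (\<Prod>k\<in>R - rays_of R u (max_cone i). x k))"
    by (subst sum.reindex[OF max_cone_inj]) simp
  also have "\<dots> = adj x"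
    unfolding adj_def by (rule sum.cong) (simp_all only: rays_of_max_cone summand_def weight_def)
  finally show "universal_adjoint \<Sigma> R u x = adj x" .
qed

text \<open>If both neighbours of a ray lay on the same side of it, the two maximal cones at that
  ray would share interior points and hence coincide by \<open>normal_cone_eqI\<close>. This makes
  the star fan of the ray a complete fan in the line.\<close>

lemma opposite_sides:
  assumes i: "i \<in> R"
  shows "det2 (u i) (u (pr i)) * det2 (u i) (u (sc i)) < 0"
proof (rule ccontr)
  assume nn: "\<not> ?thesis"
  let ?c = "u i" and ?p = "u (pr i)" and ?s = "u (sc i)"
  have dp: "det2 ?p ?c \<noteq> 0" using det2_succ[OF cyc(2)[OF i]] cyc(3)[OF i] by simp
  have ds: "det2 ?c ?s \<noteq> 0" by (rule det2_succ[OF i])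
  define \<alpha> \<beta> where "\<alpha> = det2 ?p ?s / det2 ?c ?s" and "\<beta> = det2 ?c ?p / det2 ?c ?s"
  have p: "?p = \<alpha> *\<^sub>R ?c + \<beta> *\<^sub>R ?s" unfolding \<alpha>_def \<beta>_def by (rule det2_cramer[OF ds])
  have "0 < det2 ?c ?p * det2 ?c ?s" using nn dp ds det2_swap[of ?c ?p] by (simp add: not_less order_le_less)
  then have \<beta>: "0 < \<beta>" unfolding \<beta>_def by (simp add: zero_less_divide_iff zero_less_mult_iff)
  \<comment> \<open>Large enough for \<open>N *\<^sub>R u i + u (pr i)\<close> to have positive
    coefficients also in the basis of the other cone, where \<open>u i\<close> has coefficient
    \<open>N + \<alpha>\<close>.\<close>
  define N where "N = \<bar>\<alpha>\<bar> + 1"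
  have N: "0 < N" "0 < N + \<alpha>" unfolding N_def by auto
  let ?w = "N *\<^sub>R ?c + 1 *\<^sub>R ?p"
  have w: "?w = (N + \<alpha>) *\<^sub>R ?c + \<beta> *\<^sub>R ?s" by (subst p) (simp add: algebra_simps)
  have Cp: "max_cone (pr i) = convex_cone hull {?p, ?c}" unfolding max_cone_def cyc(3)[OF i] ..
  have "?w \<in> max_cone (pr i)" unfolding Cp convex_cone_hull_pair
    using N(1) by (intro CollectI exI[of _ 1] exI[of _ N]) (simp add: add.commute)
  moreover have "?w \<in> max_cone i" unfolding max_cone_def convex_cone_hull_pair w
    using N(2) \<beta> by (intro CollectI exI[of _ "N + \<alpha>"] exI[of _ \<beta>]) simp
  moreover have "\<exists>\<epsilon>>0. ?w + \<epsilon> *\<^sub>R z \<in> max_cone i" for z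
    unfolding w max_cone_def by (rule cone_pair_interior[OF ds N(2) \<beta>])
  moreover obtain F where "max_cone (pr i) = normal_cone P F" "F face_of P" "F \<noteq> {}"
    using max_cone_in_fan[OF cyc(2)[OF i]] unfolding fan normal_fan_def by blast
  moreover obtain G where "max_cone i = normal_cone P G" "G face_of P" "G \<noteq> {}"
    using max_cone_in_fan[OF i] unfolding fan normal_fan_def by blast
  ultimately have "max_cone (pr i) = max_cone i"
    using normal_cone_eqI[of F P G ?w] face_of_imp_subset by metis
  then show False using max_cone_inj cyc(2,6)[OF i] i by (auto dest: inj_onD)
qed

lemma in_some_cone_iff: "in_some_cone \<Sigma> R u J \<longleftrightarrow> (\<exists>k\<in>R. J \<subseteq> {k, sc k})"
proof
  assume "in_some_cone \<Sigma> R u J"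
  then obtain \<sigma> where \<sigma>: "\<sigma> \<in> \<Sigma>" "J \<subseteq> rays_of R u \<sigma>" unfolding in_some_cone_def by blast
  from \<sigma>(1) show "\<exists>k\<in>R. J \<subseteq> {k, sc k}"
  proof (cases rule: cone_cases)
    case 1
    then have "J = {}" using \<sigma>(2) rays_of_zero by simp
    then show ?thesis using n3 by (auto intro!: bexI[of _ 1])
  next
    case (2 i)
    then show ?thesis using \<sigma>(2) rays_of_ray by blast
  next
    case (3 i)
    then show ?thesis using \<sigma>(2) rays_of_max_cone by blast
  qed
next
  assume "\<exists>k\<in>R. J \<subseteq> {k, sc k}"
  then show "in_some_cone \<Sigma> R u J"
    unfolding in_some_cone_def using max_cone_in_fan rays_of_max_cone by blast
qed

lemma nonadj_not_in_pair: "nonadj i j \<Longrightarrow> k \<in> R \<Longrightarrow> \<not> {i, j} \<subseteq> {k, sc k}"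
  by (auto simp: nonadj_def)

lemma nonadj_primitive:
  assumes ij: "nonadj i j"
  shows "{i, j} \<in> primitive_collections \<Sigma> R u"
  unfolding primitive_collections_def
proof (intro CollectI conjI allI impI)
  show "{i, j} \<subseteq> R" using nonadj[OF ij] by simp
  show "\<not> in_some_cone \<Sigma> R u {i, j}"
    unfolding in_some_cone_iff using nonadj_not_in_pair[OF ij] by blast
  fix J assume "J \<subset> {i, j}"
  then have "J \<subseteq> {i} \<or> J \<subseteq> {j}" by blast
  then show "in_some_cone \<Sigma> R u J"
    unfolding in_some_cone_iff using nonadj(1,2)[OF ij] by blast
qed

text \<open>By minimality a nonadjacent pair inside \<open>J\<close> is all of \<open>J\<close>.
  Without such a pair \<open>J\<close> lies among three consecutive rays but in no cone, so it
  contains both neighbours of its middle ray; these are adjacent only in a triangle.\<close>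

lemma primitive_cases:
  assumes J: "J \<in> primitive_collections \<Sigma> R u"
  shows "(\<exists>i j. nonadj i j \<and> J = {i, j}) \<or> n = 3 \<and> J = R"
proof -
  have JR: "J \<subseteq> R" and no: "\<And>k. k \<in> R \<Longrightarrow> \<not> J \<subseteq> {k, sc k}"
    and min: "\<And>J'. J' \<subset> J \<Longrightarrow> \<exists>k\<in>R. J' \<subseteq> {k, sc k}"
    using J unfolding primitive_collections_def in_some_cone_iff by blast+
  show ?thesis
  proof (cases "\<exists>i\<in>J. \<exists>j\<in>J. nonadj i j")
    case True
    then obtain i j where ij: "i \<in> J" "j \<in> J" "nonadj i j" by blast
    have "\<not> {i, j} \<subset> J" using min nonadj_not_in_pair[OF ij(3)] by blast
    then have "J = {i, j}" using ij by blast
    then show ?thesis using ij(3) by blast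
  next
    case False
    have "J \<noteq> {}" using no n3 by (metis atLeastAtMost_iff empty_subsetI le_trans one_le_numeral order_refl)
    then obtain i where i: "i \<in> J" by blast
    then have iR: "i \<in> R" using JR by blast
    have sub: "J \<subseteq> {pr i, i, sc i}"
    proof
      fix j assume j: "j \<in> J"
      then have "j \<in> R" "\<not> nonadj i j" using JR False i by auto
      then show "j \<in> {pr i, i, sc i}" using iR cyc(4)[of j] unfolding nonadj_def by auto
    qed
    have "J \<noteq> {pr i, i}" "\<not> J \<subseteq> {i, sc i}" using no[OF cyc(2)[OF iR]] no[OF iR] cyc(3)[OF iR] by auto
    moreover have "\<not> J \<subseteq> {pr i, i}" using no[OF cyc(2)[OF iR]] cyc(3)[OF iR] by simp
    ultimately have all: "pr i \<in> J" "sc i \<in> J" using sub by blast+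
    have "sc i \<noteq> sc (pr i)" "pr i \<noteq> sc i" using cyc[OF iR] by simp_all
    then have eq: "pr i = sc (sc i)"
      using False all cyc(1,2)[OF iR] unfolding nonadj_def by blast
    have "n = 3" using eq iR n3 by (auto simp: cyc_succ_def cyc_pred_def split: if_splits)
    moreover have "J = {pr i, i, sc i}" using sub all i by blast
    moreover have "card {pr i, i, sc i} = 3" using cyc[OF iR] by simp
    ultimately have "J = R" using JR by (intro card_subset_eq) auto
    then show ?thesis using \<open>n = 3\<close> by blast
  qed
qed

text \<open>All pairs except the \<open>n\<close> cones: \<open>(n choose 2) - n\<close>. In a
  triangle the only primitive collection is the set of all three rays, which this count does not
  see.\<close>

lemma card_primitive:
  assumes "4 \<le> n"
  shows "card (primitive_collections \<Sigma> R u) = n * (n - 3) div 2"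
proof -
  define E where "E = (\<lambda>k. {k, sc k}) ` R"
  have "primitive_collections \<Sigma> R u = {K. K \<subseteq> R \<and> card K = 2} - E"
  proof (intro set_eqI iffI)
    fix J assume "J \<in> primitive_collections \<Sigma> R u"
    then obtain i j where ij: "nonadj i j" "J = {i, j}" using primitive_cases assms by fastforce
    have "J \<notin> E"
    proof
      assume "J \<in> E"
      then obtain k where "k \<in> R" "{i, j} = {k, sc k}" unfolding E_def ij(2) by blast
      then show False using nonadj_not_in_pair[OF ij(1)] by blast
    qed
    then show "J \<in> {K. K \<subseteq> R \<and> card K = 2} - E"
      using nonadj(1-3)[OF ij(1)] ij(2) by simp
  next
    fix J assume J: "J \<in> {K. K \<subseteq> R \<and> card K = 2} - E"
    then obtain i j where ij: "J = {i, j}" "i \<noteq> j" by (auto simp: card_2_iff)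
    have R: "i \<in> R" "j \<in> R" using J ij by auto
    have "{i, sc i} \<in> E" "{j, sc j} \<in> E" unfolding E_def using R by blast+
    then have "nonadj i j" using J R ij unfolding nonadj_def by (auto simp: insert_commute)
    then show "J \<in> primitive_collections \<Sigma> R u" using nonadj_primitive ij by simp
  qed
  moreover have "E \<subseteq> {K. K \<subseteq> R \<and> card K = 2}"
    unfolding E_def using cyc by auto
  moreover have "card E = n"
    unfolding E_def by (subst card_image) (auto intro!: inj_onI pair_inj simp del: atLeastAtMost_iff)
  moreover have "card {K. K \<subseteq> R \<and> card K = 2} = n choose 2"
    using n_subsets[of R 2] by simp
  moreover have "finite E" unfolding E_def by simp
  ultimately have "card (primitive_collections \<Sigma> R u) = (n choose 2) - n"
    by (simp add: card_Diff_subset)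
  also have "\<dots> = n * (n - 3) div 2"
  proof -
    obtain m where m: "n = m + 3" using n3 by (metis le_add_diff_inverse2)
    have "n * (n - 1) = n * (n - 3) + 2 * n" by (simp add: m algebra_simps)
    then show ?thesis unfolding choose_two by simp
  qed
  finally show ?thesis .
qed

lemma nb_ray:
  assumes i: "i \<in> R"
  shows "nb \<Sigma> R u (convex_cone hull {u i}) = {pr i, sc i}"
proof -
  have "nb \<Sigma> R u (convex_cone hull {u i}) = {k \<in> R. \<exists>l\<in>R. {k, i} = {l, sc l}}"
    unfolding nb_def using cones_1_dim[OF i] rays_of_ray[OF i] cones_2_eq rays_of_max_cone
    by (simp add: numeral_2_eq_2[symmetric] del: atLeastAtMost_iff)
  also have "\<dots> = {pr i, sc i}"
  proof (intro set_eqI iffI)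
    fix k assume "k \<in> {k \<in> R. \<exists>l\<in>R. {k, i} = {l, sc l}}"
    then obtain l where "k \<in> R" "l \<in> R" "{k, i} = {l, sc l}" by blast
    then show "k \<in> {pr i, sc i}" using cyc(4)[of k] by (auto simp: doubleton_eq_iff)
  next
    fix k assume "k \<in> {pr i, sc i}"
    then show "k \<in> {k \<in> R. \<exists>l\<in>R. {k, i} = {l, sc l}}"
      using cyc[OF i] i by (auto simp: insert_commute simp del: atLeastAtMost_iff intro: bexI[of _ i] bexI[of _ "pr i"])
  qed
  finally show ?thesis .
qed

end

section \<open>Star fans of rays and the equations of a primitive collection\<close>

context polygon_fan
begin

lemma vector_matrix_mult_2: "(v v* A) $ j = A $ 1 $ j * v $ 1 + A $ 2 $ j * v $ 2"
  for v :: "real ^ 2" and A :: "real ^ 2 ^ 2"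
  by (simp add: vector_matrix_mult_def sum_2)

lemma det2_vector_matrix_mult: "det2 (v v* A) (w v* A) = det2 v w * det A"
  by (simp add: det2_def vector_matrix_mult_2 det_2 algebra_simps)

lemma star_cones:
  assumes i: "i \<in> R" and \<tau>: "\<tau> = convex_cone hull {u i}"
  shows "{\<sigma> \<in> \<Sigma>. \<tau> face_of \<sigma>} = {\<tau>, max_cone (pr i), max_cone i}"
proof (intro set_eqI iffI)
  fix \<sigma> assume "\<sigma> \<in> {\<sigma> \<in> \<Sigma>. \<tau> face_of \<sigma>}"
  then have \<sigma>: "\<sigma> \<in> \<Sigma>" and "\<tau> face_of \<sigma>" by auto
  then have ir: "i \<in> rays_of R u \<sigma>" using i unfolding rays_of_def \<tau> by blast
  from \<sigma> show "\<sigma> \<in> {\<tau>, max_cone (pr i), max_cone i}"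
  proof (cases rule: cone_cases)
    case 1
    then show ?thesis using ir rays_of_zero by simp
  next
    case (2 k)
    then show ?thesis using ir rays_of_ray[of k] \<tau> by simp
  next
    case (3 k)
    then have "i = k \<or> i = sc k" using ir rays_of_max_cone[of k] by simp
    then show ?thesis using 3 cyc(4)[of k] by auto
  qed
next
  fix \<sigma> assume \<sigma>: "\<sigma> \<in> {\<tau>, max_cone (pr i), max_cone i}"
  have "i \<in> rays_of R u \<tau>" "i \<in> rays_of R u (max_cone (pr i))" "i \<in> rays_of R u (max_cone i)"
    using rays_of_ray[OF i] rays_of_max_cone[OF i] rays_of_max_cone[OF cyc(2)[OF i]] cyc(3)[OF i] \<tau> by auto
  moreover have "\<tau> \<in> \<Sigma>" "max_cone (pr i) \<in> \<Sigma>" "max_cone i \<in> \<Sigma>"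
    using cones_1_dim[OF i] max_cone_in_fan cyc(2)[OF i] i \<tau> by auto
  ultimately show "\<sigma> \<in> {\<sigma> \<in> \<Sigma>. \<tau> face_of \<sigma>}"
    using \<sigma> unfolding rays_of_def \<tau> by blast
qed

lemma rays_of_ray_1:
  fixes v :: "'i \<Rightarrow> real ^ 1"
  assumes "\<And>k. k \<in> N \<Longrightarrow> v k \<noteq> 0"
  shows "rays_of N v (convex_cone hull {v i}) = {k \<in> N. v k \<in> convex_cone hull {v i}}"
proof -
  have "(convex_cone hull {v k}) face_of (convex_cone hull {v i}) \<longleftrightarrow> v k \<in> convex_cone hull {v i}"
    if "k \<in> N" for k
  proof
    assume "(convex_cone hull {v k}) face_of (convex_cone hull {v i})"
    then show "v k \<in> convex_cone hull {v i}"
      using face_of_imp_subset hull_inc[of "v k" "{v k}" convex_cone] by blast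
  next
    assume "v k \<in> convex_cone hull {v i}"
    then have "convex_cone hull {v k} = convex_cone hull {v i}"
      by (rule convex_cone_hull_single_eq[OF assms[OF that]])
    then show "(convex_cone hull {v k}) face_of (convex_cone hull {v i})"
      by (simp add: face_of_refl convex_convex_cone_hull)
  qed
  then show ?thesis unfolding rays_of_def by blast
qed

text \<open>In the adapted coordinates the quotient map is
  \<open>w \<mapsto> det A * det2 (u i) w\<close>, so the minors of the star fan are the weights of
  the two adjacent cones times \<open>\<bar>det A\<bar>\<close>. Each of its two rays contributes
  the variable of the other one.\<close>

lemma star_adjoint_eq:
  assumes i: "i \<in> R" and \<tau>: "\<tau> = convex_cone hull {u i}"
    and A: "adapted_matrix R u \<tau> A"
  shows "star_adjoint \<Sigma> R u A \<tau> x = of_real \<bar>det A\<bar> * edge_form i x"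
proof -
  define q where "q = quotient_map A"
  define v where "v = (\<lambda>k. q (u k))"
  have ui: "u i v* A = axis 1 1"
    using A rays_of_ray[OF i] unfolding adapted_matrix_def \<tau> by simp
  \<comment> \<open>As \<open>u i v* A\<close> is the first basis vector, the second coordinate of
    \<open>w v* A\<close> is its determinant with that vector.\<close>
  have q: "q w $ 1 = det A * det2 (u i) w" for w
    using det2_vector_matrix_mult[of "u i" A w] unfolding q_def quotient_map_def ui
    by (simp add: det2_def axis_def mult.commute)
  have detA: "det A \<noteq> 0"
    using A unfolding adapted_matrix_def by (simp add: invertible_det_nz)
  have v1: "v k $ 1 = det A * det2 (u i) (u k)" for k by (simp add: v_def q)
  have vi: "v i = 0" by (simp add: vec_eq_iff v1 forall_1)
  have q_lin: "q (s *\<^sub>R w + t *\<^sub>R w') = s *\<^sub>R q w + t *\<^sub>R q w'" for s t w w'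
    by (simp add: vec_eq_iff forall_1 q det2_add_scale algebra_simps)
  have q_pair: "q ` (convex_cone hull {u i, w}) = convex_cone hull {q w}" for w
  proof -
    have "q (s *\<^sub>R u i + t *\<^sub>R w) = t *\<^sub>R q w" for s t
      using vi by (simp add: q_lin v_def)
    note q_comb = this
    show ?thesis
    proof (intro set_eqI iffI)
      fix y assume "y \<in> q ` (convex_cone hull {u i, w})"
      then obtain s t where "y = q (s *\<^sub>R u i + t *\<^sub>R w)" "0 \<le> t"
        unfolding convex_cone_hull_pair by blast
      then show "y \<in> convex_cone hull {q w}" unfolding convex_cone_hull_single q_comb by blast
    next
      fix y assume "y \<in> convex_cone hull {q w}"
      then obtain t where t: "y = t *\<^sub>R q w" "0 \<le> t" unfolding convex_cone_hull_single by blast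
      have "0 *\<^sub>R u i + t *\<^sub>R w \<in> convex_cone hull {u i, w}"
        unfolding convex_cone_hull_pair using t(2) by blast
      moreover have "y = q (0 *\<^sub>R u i + t *\<^sub>R w)" using q_comb[of 0 t] t(1) by (simp only:)
      ultimately show "y \<in> q ` (convex_cone hull {u i, w})" by (rule rev_image_eqI)
    qed
  qed
  have qC: "q ` max_cone i = convex_cone hull {v (sc i)}" "q ` max_cone (pr i) = convex_cone hull {v (pr i)}"
    using q_pair[of "u (sc i)"] q_pair[of "u (pr i)"] cyc(3)[OF i]
    unfolding max_cone_def v_def by (simp_all add: insert_commute)
  have q\<tau>: "q ` \<tau> = {0}"
  proof -
    have "q (t *\<^sub>R u i) = 0" for t by (simp add: vec_eq_iff forall_1 q) (simp add: det2_def)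
    then have "q w = 0" if "w \<in> \<tau>" for w
      using that unfolding \<tau> convex_cone_hull_single by blast
    moreover have "u i \<in> \<tau>" by (simp add: \<tau> hull_inc)
    ultimately show ?thesis by (intro set_eqI) (auto intro: rev_image_eqI)
  qed
  \<comment> \<open>Opposite signs make the two image rays distinct, so that each contains only its
    own generator.\<close>
  have opp: "v (pr i) $ 1 * v (sc i) $ 1 < 0"
  proof -
    have "v (pr i) $ 1 * v (sc i) $ 1 = (det A)\<^sup>2 * (det2 (u i) (u (pr i)) * det2 (u i) (u (sc i)))"
      by (simp add: v1 power2_eq_square)
    then show ?thesis using opposite_sides[OF i] detA by (simp add: mult_less_0_iff)
  qed
  let ?N = "{pr i, sc i}"
  have nz: "v k \<noteq> 0" if "k \<in> ?N" for k using opp that by auto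
  have not_in: "v k \<notin> convex_cone hull {v l}" if "v k $ 1 * v l $ 1 < 0" for k l
  proof
    assume "v k \<in> convex_cone hull {v l}"
    then obtain t where t: "v k = t *\<^sub>R v l" "0 \<le> t" by (auto simp: convex_cone_hull_single)
    then have "v k $ 1 * v l $ 1 = t * (v l $ 1)\<^sup>2" by (simp add: power2_eq_square)
    moreover have "0 \<le> t * (v l $ 1)\<^sup>2" using t(2) by simp
    ultimately show False using that by linarith
  qed
  have self: "v k \<in> convex_cone hull {v k}" for k by (simp add: hull_inc)
  have notin: "v (pr i) \<notin> convex_cone hull {v (sc i)}" "v (sc i) \<notin> convex_cone hull {v (pr i)}"
    using not_in opp by (simp_all add: mult.commute)
  have rays_v: "rays_of ?N v (convex_cone hull {v (sc i)}) = {sc i}"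
    "rays_of ?N v (convex_cone hull {v (pr i)}) = {pr i}"
    using rays_of_ray_1[of ?N v] nz notin self by auto
  have dim1: "dim (convex_cone hull {v k}) = 1" if "k \<in> ?N" for k
    using nz[OF that] by (simp add: dim_convex_cone_hull dim_singleton)
  have "star_fan \<Sigma> A \<tau> = (`) q ` {\<sigma> \<in> \<Sigma>. \<tau> face_of \<sigma>}"
    unfolding star_fan_def q_def by blast
  also have "\<dots> = {{0}, convex_cone hull {v (pr i)}, convex_cone hull {v (sc i)}}"
    unfolding star_cones[OF i \<tau>] image_insert image_empty qC q\<tau> ..
  finally have "cones_of_dim (star_fan \<Sigma> A \<tau>) 1 =
      {convex_cone hull {v (pr i)}, convex_cone hull {v (sc i)}}"
  proof -
    assume eq: "star_fan \<Sigma> A \<tau> = {{0}, convex_cone hull {v (pr i)}, convex_cone hull {v (sc i)}}"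
    have "dim {0 :: real ^ 1} = 0" by simp
    with dim1[of "pr i"] dim1[of "sc i"] show ?thesis unfolding cones_of_dim_def eq by force
  qed
  moreover have "convex_cone hull {v (pr i)} \<noteq> convex_cone hull {v (sc i)}"
    using self notin by metis
  ultimately have "universal_adjoint (star_fan \<Sigma> A \<tau>) ?N v x =
      of_real (abs_minor v {pr i}) * (\<Prod>k\<in>?N - {pr i}. x k) +
      of_real (abs_minor v {sc i}) * (\<Prod>k\<in>?N - {sc i}. x k)"
    unfolding universal_adjoint_def by (simp add: rays_v)
  moreover have "?N - {pr i} = {sc i}" "?N - {sc i} = {pr i}" using cyc(7)[OF i] by auto
  moreover have "abs_minor v {pr i} = \<bar>det A\<bar> * weight (pr i)"
    unfolding abs_minor_1 v1 weight_eq[OF cyc(2)[OF i]] cyc(3)[OF i]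
    by (simp add: abs_mult det2_swap[of "u i"])
  moreover have "abs_minor v {sc i} = \<bar>det A\<bar> * weight i"
    unfolding abs_minor_1 v1 weight_eq[OF i] by (simp add: abs_mult)
  ultimately have "universal_adjoint (star_fan \<Sigma> A \<tau>) ?N v x = of_real \<bar>det A\<bar> * edge_form i x"
    by (simp add: edge_form_def algebra_simps)
  moreover have "dim \<tau> \<noteq> 2" using cones_1_dim[OF i] \<tau> by simp
  ultimately show ?thesis
    unfolding star_adjoint_def \<tau> nb_ray[OF i] v_def q_def by simp
qed

text \<open>Where \<open>x j = 0\<close>, the right-hand side is
  \<open>\<bar>det A\<bar> * dadj i x\<close> by \<open>dadj_nonadj\<close>; this ties the equations
  of the theorem to partial derivatives.\<close>

lemma primitive_factor_eq:
  assumes ij: "nonadj i j" and A: "adapted_matrix R u (convex_cone hull {u j}) A"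
  shows "(\<Prod>k\<in>{k \<in> R. k \<notin> nb \<Sigma> R u (convex_cone hull {u j}) \<and> k \<notin> {i, j}}. x k) *
      star_adjoint \<Sigma> R u A (convex_cone hull {u j}) x =
    of_real \<bar>det A\<bar> * (edge_form j x * (\<Prod>l\<in>R - {i, j, pr j, sc j}. x l))"
proof -
  note j = nonadj(2)[OF ij]
  have "{k \<in> R. k \<notin> nb \<Sigma> R u (convex_cone hull {u j}) \<and> k \<notin> {i, j}} = R - {i, j, pr j, sc j}"
    unfolding nb_ray[OF j] by auto
  then show ?thesis by (simp only: star_adjoint_eq[OF j refl A] mult_ac)
qed

definition pair_equations :: "((real ^ 2) set \<Rightarrow> real ^ 2 ^ 2) \<Rightarrow> nat set \<Rightarrow> ((nat \<Rightarrow> complex) \<Rightarrow> complex) set" where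
  "pair_equations T J = (\<Union>\<rho> \<in> J. let \<tau> = convex_cone hull (u ` (J - {\<rho>})) in
              {\<lambda>x. x \<rho>,
               \<lambda>x. (\<Prod>i \<in> {i \<in> R. i \<notin> nb \<Sigma> R u \<tau> \<and> i \<notin> J}. x i) *
                    star_adjoint \<Sigma> R u (T \<tau>) \<tau> x})"

lemma Ball_pair_equations:
  "(\<forall>f\<in>pair_equations T J. f x = 0) \<longleftrightarrow> (\<forall>\<rho>\<in>J. x \<rho> = 0 \<and>
    (\<Prod>i \<in> {i \<in> R. i \<notin> nb \<Sigma> R u (convex_cone hull (u ` (J - {\<rho>}))) \<and> i \<notin> J}. x i) *
      star_adjoint \<Sigma> R u (T (convex_cone hull (u ` (J - {\<rho>})))) (convex_cone hull (u ` (J - {\<rho>}))) x = 0)"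
  unfolding pair_equations_def Let_def
  by (simp only: ball_UN ball_simps simp_thms)

text \<open>The indices cross over: the equation for \<open>i\<close> uses the star of the ray
  \<open>j\<close> and, as \<open>x j = 0\<close>, is a nonzero multiple of \<open>dadj i\<close>;
  likewise with \<open>i\<close> and \<open>j\<close> exchanged.\<close>

lemma pair_equations_iff:
  assumes ij: "nonadj i j" and T: "\<And>\<tau>. \<tau> \<in> cones_of_dim \<Sigma> 1 \<Longrightarrow> adapted_matrix R u \<tau> (T \<tau>)"
  shows "(\<forall>f\<in>pair_equations T {i, j}. f x = 0) \<longleftrightarrow>
    x i = 0 \<and> x j = 0 \<and> dadj i x = 0 \<and> dadj j x = 0"
proof -
  define F where "F = (\<lambda>j. T (convex_cone hull {u j}))"
  have A: "adapted_matrix R u (convex_cone hull {u k}) (F k)" if "k \<in> R" for k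
    using T cones_1 that unfolding F_def by blast
  then have detF: "det (F k) \<noteq> 0" if "k \<in> R" for k
    using that unfolding adapted_matrix_def by (simp add: invertible_det_nz)
  note n = nonadj[OF ij]
  have d: "{i, j} - {i} = {j}" "{i, j} - {j} = {i}" using n(3) by auto
  define G where "G = (\<lambda>\<rho>. x \<rho> = 0 \<and>
    (\<Prod>k \<in> {k \<in> R. k \<notin> nb \<Sigma> R u (convex_cone hull (u ` ({i, j} - {\<rho>}))) \<and> k \<notin> {i, j}}. x k) *
      star_adjoint \<Sigma> R u (T (convex_cone hull (u ` ({i, j} - {\<rho>}))))
        (convex_cone hull (u ` ({i, j} - {\<rho>}))) x = 0)"
  have "(\<forall>f\<in>pair_equations T {i, j}. f x = 0) \<longleftrightarrow> G i \<and> G j"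
    unfolding Ball_pair_equations G_def by blast
  moreover have "G i \<longleftrightarrow> x i = 0 \<and>
      of_real \<bar>det (F j)\<bar> * (edge_form j x * (\<Prod>l\<in>R - {i, j, pr j, sc j}. x l)) = 0"
    unfolding G_def d image_insert image_empty primitive_factor_eq[OF ij A[OF n(2)], symmetric]
    unfolding F_def ..
  moreover have "G j \<longleftrightarrow> x j = 0 \<and>
      of_real \<bar>det (F i)\<bar> * (edge_form i x * (\<Prod>l\<in>R - {j, i, pr i, sc i}. x l)) = 0"
    unfolding G_def d image_insert image_empty
      primitive_factor_eq[OF nonadj_sym[OF ij] A[OF n(1)], symmetric]
    unfolding F_def insert_commute[of j i "{}"] ..
  ultimately have "(\<forall>f\<in>pair_equations T {i, j}. f x = 0) \<longleftrightarrow> (x i = 0 \<and>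
      of_real \<bar>det (F j)\<bar> * (edge_form j x * (\<Prod>l\<in>R - {i, j, pr j, sc j}. x l)) = 0) \<and>
      (x j = 0 \<and>
      of_real \<bar>det (F i)\<bar> * (edge_form i x * (\<Prod>l\<in>R - {j, i, pr i, sc i}. x l)) = 0)"
    by (simp only:)
  also have "\<dots> \<longleftrightarrow> x i = 0 \<and> x j = 0 \<and> dadj i x = 0 \<and> dadj j x = 0"
  proof (cases "x i = 0 \<and> x j = 0")
    case True
    have "complex_of_real \<bar>det (F i)\<bar> \<noteq> 0" "complex_of_real \<bar>det (F j)\<bar> \<noteq> 0"
      using detF[OF n(1)] detF[OF n(2)] by simp_all
    with True show ?thesis
      using dadj_nonadj[of i j x, OF ij] dadj_nonadj[of j i x, OF nonadj_sym[OF ij]]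
      by (simp only: mult_eq_0_iff simp_thms)
  next
    case False
    then show ?thesis by blast
  qed
  finally show ?thesis .
qed

end

section \<open>The singular locus and the primitive collections\<close>

locale generic_polygon_fan = polygon_fan +
  assumes generic_weights: "\<not> 4 dvd n \<or>
    (\<Prod>i = 1..n div 2. weight (2 * i - 1)) \<noteq> weight n * (\<Prod>i = 1..n div 2 - 1. weight (2 * i))"
begin

sublocale generic_cyclic_adjoint n weight
  by unfold_locales (rule generic_weights)

text \<open>A singular point has two nonadjacent zeros, which form a primitive collection whose
  equations it satisfies. Conversely, the equations of a pair kill its two partial derivatives, and
  its two zeros kill all the others.\<close>

lemma sing_eq:
  assumes T: "\<And>\<tau>. \<tau> \<in> cones_of_dim \<Sigma> 1 \<Longrightarrow> adapted_matrix R u \<tau> (T \<tau>)"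
  shows "sing = (\<Union>J \<in> primitive_collections \<Sigma> R u. proj_zeros R (pair_equations T J))"
proof (intro set_eqI iffI)
  fix p assume p: "p \<in> sing"
  then have ps: "p \<in> proj_space R" by (simp add: sing_def proj_zeros_def)
  then obtain x where "p = proj_point x" unfolding proj_space_def by auto
  then have xp: "x \<in> p" unfolding proj_point_def by (auto intro!: exI[of _ 1])
  obtain i j where ij: "nonadj i j" "x i = 0" "x j = 0" using sing_obtain_nonadj[OF p xp] by blast
  have "\<forall>f\<in>pair_equations T {i, j}. f y = 0" if y: "y \<in> p" for y
  proof (rule pair_equations_iff[THEN iffD2, OF ij(1) T]; (intro conjI)?)
    obtain c where c: "y = (\<lambda>i. c * x i)" using scale_in_proj_space[OF ps xp y] by blast
    show "y i = 0" "y j = 0" using ij(2,3) c by simp_all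
    have d: "dadj k y = 0" if "k \<in> R" for k
      by (rule proj_zerosD[OF p[unfolded sing_def] imageI[OF that] y])
    show "dadj i y = 0" "dadj j y = 0" by (rule d, rule nonadj[OF ij(1)])+
  qed
  then have "p \<in> proj_zeros R (pair_equations T {i, j})"
    using ps unfolding proj_zeros_def by blast
  then show "p \<in> (\<Union>J \<in> primitive_collections \<Sigma> R u. proj_zeros R (pair_equations T J))"
    using nonadj_primitive[OF ij(1)] by blast
next
  fix p assume "p \<in> (\<Union>J \<in> primitive_collections \<Sigma> R u. proj_zeros R (pair_equations T J))"
  then obtain J where J: "J \<in> primitive_collections \<Sigma> R u" and p: "p \<in> proj_zeros R (pair_equations T J)"
    by blast
  have ps: "p \<in> proj_space R" using p by (simp add: proj_zeros_def)
  have zero: "\<forall>f\<in>pair_equations T J. f y = 0" if "y \<in> p" for y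
    using proj_zerosD[OF p _ that] by (rule ballI)
  from primitive_cases[OF J] show "p \<in> sing"
  proof
    assume "\<exists>i j. nonadj i j \<and> J = {i, j}"
    then obtain i j where ij: "nonadj i j" "J = {i, j}" by blast
    have "dadj m y = 0" if "y \<in> p" for m y
    proof -
      have "y i = 0 \<and> y j = 0 \<and> dadj i y = 0 \<and> dadj j y = 0"
        using zero[OF that] by (intro pair_equations_iff[THEN iffD1, OF ij(1) T]) (simp_all add: ij(2))
      then show ?thesis
        using dadj_nonadj_other[of i j y m, OF ij(1)] by (cases "m = i \<or> m = j") auto
    qed
    then show ?thesis using ps unfolding sing_def proj_zeros_def by blast
  next
    \<comment> \<open>For the triangle the equations make all coordinates vanish, which no
      projective point satisfies.\<close>
    assume J: "n = 3 \<and> J = R"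
    obtain x where x: "p = proj_point x" "\<exists>i\<in>R. x i \<noteq> 0" using ps unfolding proj_space_def by blast
    have "x \<in> p" unfolding x(1) proj_point_def by (rule CollectI, rule exI[of _ 1]) simp
    then have "\<forall>\<rho>\<in>R. x \<rho> = 0" using zero[of x] J unfolding Ball_pair_equations by blast
    then show ?thesis using x(2) by blast
  qed
qed

end

theorem theorem7p11:
  fixes P :: "(real ^ 2) set"
    and n :: nat
    and \<Sigma> :: "(real ^ 2) set set"
    and u :: "nat \<Rightarrow> real ^ 2"
    and T :: "(real ^ 2) set \<Rightarrow> real ^ 2 ^ 2"
  assumes polygon: "polytope P" "aff_dim P = 2" "card {v. v extreme_point_of P} = n"
    and fan: "\<Sigma> = normal_fan P"
    and rays: "is_ray_matrix \<Sigma> {1..n} u"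
    and maximal_cones:
      "cones_of_dim \<Sigma> 2 =
         (\<lambda>i. convex_cone hull {u i, u (i + 1)}) ` {1..<n} \<union> {convex_cone hull {u 1, u n}}"
    and charts: "\<forall>\<tau> \<in> cones_of_dim \<Sigma> 1. adapted_matrix {1..n} u \<tau> (T \<tau>)"
    and generic:
      "\<not> 4 dvd n \<or>
       (\<Prod>i = 1..n div 2. abs_minor u {2 * i - 1, 2 * i}) \<noteq>
       abs_minor u {1, n} * (\<Prod>i = 1..n div 2 - 1. abs_minor u {2 * i, 2 * i + 1})"
  shows "(adjoint_sing \<Sigma> {1..n} u =
      (\<Union>J \<in> primitive_collections \<Sigma> {1..n} u.
         proj_zeros {1..n}
           (\<Union>\<rho> \<in> J. let \<tau> = convex_cone hull (u ` (J - {\<rho>})) in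
              {\<lambda>x. x \<rho>,
               \<lambda>x. (\<Prod>i \<in> {i \<in> {1..n}. i \<notin> nb \<Sigma> {1..n} u \<tau> \<and> i \<notin> J}. x i) *
                    star_adjoint \<Sigma> {1..n} u (T \<tau>) \<tau> x})))
    \<and> (4 \<le> n \<longrightarrow> card (primitive_collections \<Sigma> {1..n} u) = n * (n - 3) div 2)
    \<and> zariski_irreducible {1..n} (adjoint_hypersurface \<Sigma> {1..n} u)
    \<and> zariski_dim {1..n} (adjoint_sing \<Sigma> {1..n} u) \<le> ereal (real n - 4)"
proof -
  have n3: "3 \<le> n" using extreme_points_card_ge[OF polygon(1)] polygon(2,3) by simp
  \<comment> \<open>The separately listed cone of the rays 1 and \<open>n\<close> is the cone of
    \<open>n\<close> and its cyclic successor.\<close>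
  have "{1..n} = insert n {1..<n}" using n3 by auto
  then have "(\<lambda>i. convex_cone hull {u i, u (cyc_succ n i)}) ` {1..n} =
      insert (convex_cone hull {u n, u 1}) ((\<lambda>i. convex_cone hull {u i, u (cyc_succ n i)}) ` {1..<n})"
    by (simp add: cyc_succ_def)
  also have "(\<lambda>i. convex_cone hull {u i, u (cyc_succ n i)}) ` {1..<n} =
      (\<lambda>i. convex_cone hull {u i, u (i + 1)}) ` {1..<n}"
    by (rule image_cong) (auto simp: cyc_succ_def)
  finally have cones: "cones_of_dim \<Sigma> 2 = (\<lambda>i. convex_cone hull {u i, u (cyc_succ n i)}) ` {1..n}"
    using maximal_cones by (simp add: insert_commute)
  interpret polygon_fan P n \<Sigma> u
    by unfold_locales (rule n3 fan rays cones)+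
  \<comment> \<open>In both products the successor stays within \<open>1..n\<close> without wrapping
    around; only the weight of \<open>n\<close> is the wrapped one.\<close>
  have "(\<Prod>i = 1..n div 2. weight (2 * i - 1)) = (\<Prod>i = 1..n div 2. abs_minor u {2 * i - 1, 2 * i})"
  proof (rule prod.cong[OF refl])
    fix i assume "i \<in> {1..n div 2}"
    then have "2 * i - 1 \<noteq> n" "Suc (2 * i - 1) = 2 * i" by auto
    then show "weight (2 * i - 1) = abs_minor u {2 * i - 1, 2 * i}"
      by (simp add: weight_def cyc_succ_def)
  qed
  moreover have "(\<Prod>i = 1..n div 2 - 1. weight (2 * i)) = (\<Prod>i = 1..n div 2 - 1. abs_minor u {2 * i, 2 * i + 1})"
    by (rule prod.cong[OF refl]) (auto simp: weight_def cyc_succ_def)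
  moreover have "weight n = abs_minor u {1, n}"
    by (simp add: weight_def cyc_succ_def insert_commute)
  ultimately interpret generic_polygon_fan P n \<Sigma> u
    by unfold_locales (use generic in simp)
  have hyp: "adjoint_hypersurface \<Sigma> R u = proj_zeros R {adj}"
    by (simp only: adjoint_hypersurface_def universal_adjoint_eq)
  have "(\<lambda>i. partial_deriv i (universal_adjoint \<Sigma> R u)) ` R = dadj ` R"
    unfolding universal_adjoint_eq by (intro image_cong refl ext partial_deriv_adj)
  then have sing: "adjoint_sing \<Sigma> R u = sing" by (simp only: adjoint_sing_def sing_def)
  have "adjoint_sing \<Sigma> R u =
      (\<Union>J \<in> primitive_collections \<Sigma> R u. proj_zeros R (pair_equations T J))"
    unfolding sing by (rule sing_eq) (use charts in blast)
  then show ?thesis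
    using card_primitive irreducible_adj zariski_dim_sing_le
    unfolding hyp sing pair_equations_def by blast
qed

end
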